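(* Let $(X,G,\Phi)$ be a dynamical system, where $X$ is a compact totally disconnected Hausdorff space. Let property $P$ be one of the following properties: transitivity, minimality, total transitivity, weak mixing, mixing, and the specification property. Then $\Phi$ has property $P$ if and only if $(X,G,\Phi)$ is conjugate to the inverse limit of an ML inverse system of subshifts (over $G$) with property $P$.
   Context: $G$ is a countable discrete group with identity $e_G$. A dynamical system $(X,G,\Phi)$ consists of a compact Hausdorff space $X$ and $\Phi:G\times X\to X$ such that each $\Phi_g:=\Phi(g,\cdot)$ is a homeomorphism, $\Phi_{e_G}=\mathrm{id}_X$ and $\Phi_{gg'}=\Phi_g\circ\Phi_{g'}$. Dynamical properties. For nonempty $U,V\subset X$ let $N(U,V)=\{g\in G\setminus\{e_G\}:U\cap\Phi_{g^{-1}}(V)\neq\emptyset\}$. The system $(X,G,\Phi)$ (or $\Phi$) is: - transitive if $N(U,V)$ is infinite for all nonempty open $U,V\subset X$; - totally transitive if for any countable subset $K\subset G$ and any two nonempty open $U,V\subset X$, $N(U,V)\cap G'\neq\emptyset$, where $G'$ is the group generated by $K$; - minimal if it contains no proper subsystem (no proper nonempty closed $G$-invariant subset); - weakly mixing if $(X\times X,G,\Phi\times\Phi)$ is transitive, where $(\Phi\times\Phi)_g=\Phi_g\times\Phi_g$; - mixing if $G\setminus N(U,V)$ is finite for all nonempty open $U,V\subset X$. $\Phi$ has the specification property if for every finite open cover $\mathcal U$ of $X$ there is a nonempty finite $F\subset G$ such that: for any finite collection $F_1,\dots,F_m$ of finite subsets of $G$ with $FF_i\cap F_j=\emptyset$ for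 all $i\ne j$, and any $x_1,\dots,x_m\in X$, there is $y\in X$ such that for each $i$ and each $s\in F_i$ there is $U_{(i,s)}\in\mathcal U$ with $\Phi_s(y),\Phi_s(x_i)\in U_{(i,s)}$. Subshifts. For a finite set $\Sigma$, $G$ acts on $\Sigma^G$ (product topology, $\Sigma$ discrete) by $\sigma_g(x)(h)=x(hg)$. A subshift is a closed $G$-invariant subset of some $\Sigma^G$, regarded as a dynamical system under $\sigma$. Inverse limits. For a directed set $(\Lambda,\le)$, an inverse system $(\phi^\eta_\lambda,(X_\lambda,G,\Phi^\lambda))$ of dynamical systems consists of dynamical systems $(X_\lambda,G,\Phi^\lambda)$, $\lambda\in\Lambda$, and continuous (not necessarily surjective) maps $\phi^\eta_\lambda:X_\eta\to X_\lambda$ for $\lambda\le\eta$ with $\phi^\lambda_\lambda=\mathrm{id}$, $\phi^\gamma_\lambda=\phi^\eta_\lambda\circ\phi^\gamma_\eta$ for $\lambda\le\eta\le\gamma$, and $\Phi^\lambda_g\circ\phi^\eta_\lambda=\phi^\eta_\lambda\circ\Phi^\eta_g$ for all $g\in G$. Its inverse limit is the space of all $(x_\lambda)\in\prod_\lambda X_\lambda$ with $x_\lambda=\phi^\eta_\lambda(x_\eta)$ for all $\lambda\le\eta$, with the subspace topology and the coordinatewise $G$-action. It is an ML inverse system (satisfies the Mittag-Leffler condition) if for every $\lambda$ there is $\eta\ge\lambda$ such that $\phi^\gamma_\lambda(X_\gamma)=\phi^\eta_\lambda(X_\eta)$ for all $\gamma\ge\eta$. Two systems are conjugate if there is a $G$-equivariant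 homeomorphism between them. *)

theory Defs
  imports "HOL-Analysis.Analysis" "HOL-Algebra.Generated_Groups"
begin

text \<open>
  Actions of a discrete group G on a topological space X, given as an abstract topology.
  The action is a function \<^term>\<open>\<Phi>\<close> with \<^term>\<open>\<Phi> g x\<close> relevant only for g in
  \<^term>\<open>carrier G\<close> and x in \<^term>\<open>topspace X\<close>. The empty system is not excluded.
\<close>

definition dynamical_system ::
    "('g, 'm) monoid_scheme \<Rightarrow> 'a topology \<Rightarrow> ('g \<Rightarrow> 'a \<Rightarrow> 'a) \<Rightarrow> bool" where
  "dynamical_system G X \<Phi> \<longleftrightarrow>
     compact_space X \<and> Hausdorff_space X \<and>
     (\<forall>g\<in>carrier G. homeomorphic_map X X (\<Phi> g)) \<and>
     (\<forall>x\<in>topspace X. \<Phi> \<one>\<^bsub>G\<^esub> x = x) \<and>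
     (\<forall>g\<in>carrier G. \<forall>h\<in>carrier G. \<forall>x\<in>topspace X. \<Phi> (g \<otimes>\<^bsub>G\<^esub> h) x = \<Phi> g (\<Phi> h x))"

definition totally_disconnected_space :: "'a topology \<Rightarrow> bool" where
  "totally_disconnected_space X \<longleftrightarrow> (\<forall>S. connectedin X S \<longrightarrow> (\<exists>a. S \<subseteq> {a}))"

definition return_set ::
    "('g, 'm) monoid_scheme \<Rightarrow> ('g \<Rightarrow> 'a \<Rightarrow> 'a) \<Rightarrow> 'a set \<Rightarrow> 'a set \<Rightarrow> 'g set" where
  "return_set G \<Phi> U V = {g \<in> carrier G - {\<one>\<^bsub>G\<^esub>}. U \<inter> \<Phi> (inv\<^bsub>G\<^esub> g) ` V \<noteq> {}}"

definition transitive_system ::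
    "('g, 'm) monoid_scheme \<Rightarrow> 'a topology \<Rightarrow> ('g \<Rightarrow> 'a \<Rightarrow> 'a) \<Rightarrow> bool" where
  "transitive_system G X \<Phi> \<longleftrightarrow>
     (\<forall>U V. openin X U \<and> openin X V \<and> U \<noteq> {} \<and> V \<noteq> {} \<longrightarrow> infinite (return_set G \<Phi> U V))"

definition totally_transitive_system ::
    "('g, 'm) monoid_scheme \<Rightarrow> 'a topology \<Rightarrow> ('g \<Rightarrow> 'a \<Rightarrow> 'a) \<Rightarrow> bool" where
  "totally_transitive_system G X \<Phi> \<longleftrightarrow>
     (\<forall>K U V. K \<subseteq> carrier G \<and> countable K \<and>
        openin X U \<and> openin X V \<and> U \<noteq> {} \<and> V \<noteq> {} \<longrightarrow>
        return_set G \<Phi> U V \<inter> generate G K \<noteq> {})"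

text \<open>
  Return sets exclude the identity, so if K may be empty (or consist of the identity only),
  no nonempty system satisfies \<^const>\<open>totally_transitive_system\<close>. The following variant
  reads ``countable'' as ``countably infinite''; it is the one that mixing implies.
\<close>

definition totally_transitive_system_inf ::
    "('g, 'm) monoid_scheme \<Rightarrow> 'a topology \<Rightarrow> ('g \<Rightarrow> 'a \<Rightarrow> 'a) \<Rightarrow> bool" where
  "totally_transitive_system_inf G X \<Phi> \<longleftrightarrow>
     (\<forall>K U V. K \<subseteq> carrier G \<and> countable K \<and> infinite K \<and>
        openin X U \<and> openin X V \<and> U \<noteq> {} \<and> V \<noteq> {} \<longrightarrow>
        return_set G \<Phi> U V \<inter> generate G K \<noteq> {})"

definition minimal_system ::
    "('g, 'm) monoid_scheme \<Rightarrow> 'a topology \<Rightarrow> ('g \<Rightarrow> 'a \<Rightarrow> 'a) \<Rightarrow> bool" where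
  "minimal_system G X \<Phi> \<longleftrightarrow>
     (\<forall>C. closedin X C \<and> C \<noteq> {} \<and> (\<forall>g\<in>carrier G. \<Phi> g ` C \<subseteq> C) \<longrightarrow> C = topspace X)"

definition weakly_mixing_system ::
    "('g, 'm) monoid_scheme \<Rightarrow> 'a topology \<Rightarrow> ('g \<Rightarrow> 'a \<Rightarrow> 'a) \<Rightarrow> bool" where
  "weakly_mixing_system G X \<Phi> \<longleftrightarrow>
     transitive_system G (prod_topology X X) (\<lambda>g. map_prod (\<Phi> g) (\<Phi> g))"

definition mixing_system ::
    "('g, 'm) monoid_scheme \<Rightarrow> 'a topology \<Rightarrow> ('g \<Rightarrow> 'a \<Rightarrow> 'a) \<Rightarrow> bool" where
  "mixing_system G X \<Phi> \<longleftrightarrow>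
     (\<forall>U V. openin X U \<and> openin X V \<and> U \<noteq> {} \<and> V \<noteq> {} \<longrightarrow>
        finite (carrier G - return_set G \<Phi> U V))"

definition specification_property ::
    "('g, 'm) monoid_scheme \<Rightarrow> 'a topology \<Rightarrow> ('g \<Rightarrow> 'a \<Rightarrow> 'a) \<Rightarrow> bool" where
  "specification_property G X \<Phi> \<longleftrightarrow>
     (\<forall>\<U>. finite \<U> \<and> (\<forall>U\<in>\<U>. openin X U) \<and> \<Union>\<U> = topspace X \<longrightarrow>
       (\<exists>F. finite F \<and> F \<noteq> {} \<and> F \<subseteq> carrier G \<and>
         (\<forall>(m::nat) (Fs :: nat \<Rightarrow> 'g set) (x :: nat \<Rightarrow> 'a).
            m \<ge> 1 \<and>
            (\<forall>i\<in>{1..m}. finite (Fs i) \<and> Fs i \<subseteq> carrier G \<and> x i \<in> topspace X) \<and>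
            (\<forall>i\<in>{1..m}. \<forall>j\<in>{1..m}. i \<noteq> j \<longrightarrow> (F <#>\<^bsub>G\<^esub> Fs i) \<inter> Fs j = {}) \<longrightarrow>
            (\<exists>y\<in>topspace X. \<forall>i\<in>{1..m}. \<forall>s\<in>Fs i. \<exists>U\<in>\<U>. \<Phi> s y \<in> U \<and> \<Phi> s (x i) \<in> U))))"

datatype dyn_property =
    Transitivity
  | Minimality
  | Total_Transitivity
  | Total_Transitivity_Inf
  | Weak_Mixing
  | Mixing
  | Specification

definition has_property ::
    "dyn_property \<Rightarrow> ('g, 'm) monoid_scheme \<Rightarrow> 'a topology \<Rightarrow> ('g \<Rightarrow> 'a \<Rightarrow> 'a) \<Rightarrow> bool" where
  "has_property P G X \<Phi> =
     (case P of
        Transitivity \<Rightarrow> transitive_system G X \<Phi>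
      | Minimality \<Rightarrow> minimal_system G X \<Phi>
      | Total_Transitivity \<Rightarrow> totally_transitive_system G X \<Phi>
      | Total_Transitivity_Inf \<Rightarrow> totally_transitive_system_inf G X \<Phi>
      | Weak_Mixing \<Rightarrow> weakly_mixing_system G X \<Phi>
      | Mixing \<Rightarrow> mixing_system G X \<Phi>
      | Specification \<Rightarrow> specification_property G X \<Phi>)"

text \<open>
  Configurations over an alphabet A are the functions that are A-valued on
  \<^term>\<open>carrier G\<close> and \<^const>\<open>undefined\<close> elsewhere; hence the restriction in the shift.
\<close>

definition full_shift :: "('g, 'm) monoid_scheme \<Rightarrow> 's set \<Rightarrow> ('g \<Rightarrow> 's) topology" where
  "full_shift G A = product_topology (\<lambda>_. discrete_topology A) (carrier G)"

definition shift_action :: "('g, 'm) monoid_scheme \<Rightarrow> 'g \<Rightarrow> ('g \<Rightarrow> 's) \<Rightarrow> ('g \<Rightarrow> 's)" where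
  "shift_action G g x = (\<lambda>h\<in>carrier G. x (h \<otimes>\<^bsub>G\<^esub> g))"

definition subshift :: "('g, 'm) monoid_scheme \<Rightarrow> 's set \<Rightarrow> ('g \<Rightarrow> 's) set \<Rightarrow> bool" where
  "subshift G A S \<longleftrightarrow>
     finite A \<and> closedin (full_shift G A) S \<and> (\<forall>g\<in>carrier G. shift_action G g ` S \<subseteq> S)"

definition subshift_space ::
    "('g, 'm) monoid_scheme \<Rightarrow> 's set \<Rightarrow> ('g \<Rightarrow> 's) set \<Rightarrow> ('g \<Rightarrow> 's) topology" where
  "subshift_space G A S = subtopology (full_shift G A) S"

definition directed_set :: "'i set \<Rightarrow> ('i \<Rightarrow> 'i \<Rightarrow> bool) \<Rightarrow> bool" where
  "directed_set \<Lambda> leq \<longleftrightarrow>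
     \<Lambda> \<noteq> {} \<and>
     (\<forall>a\<in>\<Lambda>. leq a a) \<and>
     (\<forall>a\<in>\<Lambda>. \<forall>b\<in>\<Lambda>. \<forall>c\<in>\<Lambda>. leq a b \<and> leq b c \<longrightarrow> leq a c) \<and>
     (\<forall>a\<in>\<Lambda>. \<forall>b\<in>\<Lambda>. \<exists>c\<in>\<Lambda>. leq a c \<and> leq b c)"

text \<open>The bonding map \<^term>\<open>\<phi> \<eta> l\<close> goes from \<^term>\<open>Y \<eta>\<close> to \<^term>\<open>Y l\<close>, for l below \<^term>\<open>\<eta>\<close>.\<close>

definition inverse_system ::
    "('g, 'm) monoid_scheme \<Rightarrow> 'i set \<Rightarrow> ('i \<Rightarrow> 'i \<Rightarrow> bool) \<Rightarrow> ('i \<Rightarrow> 'b topology) \<Rightarrow>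
     ('i \<Rightarrow> 'g \<Rightarrow> 'b \<Rightarrow> 'b) \<Rightarrow> ('i \<Rightarrow> 'i \<Rightarrow> 'b \<Rightarrow> 'b) \<Rightarrow> bool" where
  "inverse_system G \<Lambda> leq Y \<Psi> \<phi> \<longleftrightarrow>
     directed_set \<Lambda> leq \<and>
     (\<forall>l\<in>\<Lambda>. dynamical_system G (Y l) (\<Psi> l)) \<and>
     (\<forall>l\<in>\<Lambda>. \<forall>\<eta>\<in>\<Lambda>. leq l \<eta> \<longrightarrow> continuous_map (Y \<eta>) (Y l) (\<phi> \<eta> l)) \<and>
     (\<forall>l\<in>\<Lambda>. \<forall>x\<in>topspace (Y l). \<phi> l l x = x) \<and>
     (\<forall>l\<in>\<Lambda>. \<forall>\<eta>\<in>\<Lambda>. \<forall>\<gamma>\<in>\<Lambda>. leq l \<eta> \<and> leq \<eta> \<gamma> \<longrightarrow>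
        (\<forall>x\<in>topspace (Y \<gamma>). \<phi> \<gamma> l x = \<phi> \<eta> l (\<phi> \<gamma> \<eta> x))) \<and>
     (\<forall>l\<in>\<Lambda>. \<forall>\<eta>\<in>\<Lambda>. leq l \<eta> \<longrightarrow>
        (\<forall>g\<in>carrier G. \<forall>x\<in>topspace (Y \<eta>). \<Psi> l g (\<phi> \<eta> l x) = \<phi> \<eta> l (\<Psi> \<eta> g x)))"

definition mittag_leffler ::
    "'i set \<Rightarrow> ('i \<Rightarrow> 'i \<Rightarrow> bool) \<Rightarrow> ('i \<Rightarrow> 'b topology) \<Rightarrow> ('i \<Rightarrow> 'i \<Rightarrow> 'b \<Rightarrow> 'b) \<Rightarrow> bool" where
  "mittag_leffler \<Lambda> leq Y \<phi> \<longleftrightarrow>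
     (\<forall>l\<in>\<Lambda>. \<exists>\<eta>\<in>\<Lambda>. leq l \<eta> \<and>
        (\<forall>\<gamma>\<in>\<Lambda>. leq \<eta> \<gamma> \<longrightarrow> \<phi> \<gamma> l ` topspace (Y \<gamma>) = \<phi> \<eta> l ` topspace (Y \<eta>)))"

definition inverse_limit ::
    "'i set \<Rightarrow> ('i \<Rightarrow> 'i \<Rightarrow> bool) \<Rightarrow> ('i \<Rightarrow> 'b topology) \<Rightarrow> ('i \<Rightarrow> 'i \<Rightarrow> 'b \<Rightarrow> 'b) \<Rightarrow>
     ('i \<Rightarrow> 'b) topology" where
  "inverse_limit \<Lambda> leq Y \<phi> =
     subtopology (product_topology Y \<Lambda>)
       {x. \<forall>l\<in>\<Lambda>. \<forall>\<eta>\<in>\<Lambda>. leq l \<eta> \<longrightarrow> x l = \<phi> \<eta> l (x \<eta>)}"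

definition limit_action ::
    "'i set \<Rightarrow> ('i \<Rightarrow> 'g \<Rightarrow> 'b \<Rightarrow> 'b) \<Rightarrow> 'g \<Rightarrow> ('i \<Rightarrow> 'b) \<Rightarrow> ('i \<Rightarrow> 'b)" where
  "limit_action \<Lambda> \<Psi> g x = (\<lambda>l\<in>\<Lambda>. \<Psi> l g (x l))"

definition conjugate ::
    "('g, 'm) monoid_scheme \<Rightarrow> 'a topology \<Rightarrow> ('g \<Rightarrow> 'a \<Rightarrow> 'a) \<Rightarrow>
     'b topology \<Rightarrow> ('g \<Rightarrow> 'b \<Rightarrow> 'b) \<Rightarrow> bool" where
  "conjugate G X \<Phi> Y \<Psi> \<longleftrightarrow>
     (\<exists>h. homeomorphic_map X Y h \<and>
          (\<forall>g\<in>carrier G. \<forall>x\<in>topspace X. h (\<Phi> g x) = \<Psi> g (h x)))"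

text \<open>
  The index type \<^typ>\<open>'i\<close> and the alphabet type \<^typ>\<open>'s\<close> are arbitrary. Where a system has to be
  asserted to exist, alphabets in \<^typ>\<open>nat\<close> and indices in \<^typ>\<open>'a set set\<close>, which contains all
  finite clopen partitions of a space on \<^typ>\<open>'a\<close>, can be used.
\<close>

definition mittag_leffler_system_of_subshifts ::
    "dyn_property \<Rightarrow> ('g, 'm) monoid_scheme \<Rightarrow> 'i set \<Rightarrow> ('i \<Rightarrow> 'i \<Rightarrow> bool) \<Rightarrow> ('i \<Rightarrow> 's set) \<Rightarrow>
     ('i \<Rightarrow> ('g \<Rightarrow> 's) set) \<Rightarrow> ('i \<Rightarrow> 'i \<Rightarrow> ('g \<Rightarrow> 's) \<Rightarrow> ('g \<Rightarrow> 's)) \<Rightarrow> bool" where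
  "mittag_leffler_system_of_subshifts P G \<Lambda> leq A S \<phi> \<longleftrightarrow>
     (\<forall>l\<in>\<Lambda>. subshift G (A l) (S l) \<and>
            has_property P G (subshift_space G (A l) (S l)) (shift_action G)) \<and>
     inverse_system G \<Lambda> leq (\<lambda>l. subshift_space G (A l) (S l)) (\<lambda>_. shift_action G) \<phi> \<and>
     mittag_leffler \<Lambda> leq (\<lambda>l. subshift_space G (A l) (S l)) \<phi>"

definition conjugate_to_limit_of_subshifts ::
    "('g, 'm) monoid_scheme \<Rightarrow> 'a topology \<Rightarrow> ('g \<Rightarrow> 'a \<Rightarrow> 'a) \<Rightarrow>
     'i set \<Rightarrow> ('i \<Rightarrow> 'i \<Rightarrow> bool) \<Rightarrow> ('i \<Rightarrow> 's set) \<Rightarrow> ('i \<Rightarrow> ('g \<Rightarrow> 's) set) \<Rightarrow>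
     ('i \<Rightarrow> 'i \<Rightarrow> ('g \<Rightarrow> 's) \<Rightarrow> ('g \<Rightarrow> 's)) \<Rightarrow> bool" where
  "conjugate_to_limit_of_subshifts G X \<Phi> \<Lambda> leq A S \<phi> \<longleftrightarrow>
     conjugate G X \<Phi>
       (inverse_limit \<Lambda> leq (\<lambda>l. subshift_space G (A l) (S l)) \<phi>)
       (limit_action \<Lambda> (\<lambda>_. shift_action G))"

end

theory Submission
  imports Defs
begin

text \<open>
  Each of the properties passes to factors, and it passes from a directed family of factors of a
  compact system to the system itself as soon as the preimages of open sets of the factors form a
  base. For an inverse limit, compactness and the Mittag-Leffler condition identify the image of the
  projection to an index with a stable image of a bonding map; this is a factor of one of the
  given subshifts, and these images form such a directed family. Conversely, each finite clopen
  partition sends a point to its itinerary through the cells. The sets of itineraries are subshifts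
  and factors of the system, they are directed by refinement with surjective bonding maps, and they
  separate points because quasi-components of a compact Hausdorff space are connected.
\<close>

section \<open>Factors\<close>

text \<open>The obstacle is that the projection of a limit to \<open>Y l\<close> need not be onto,
  and in general the properties do not pass to subsystems, so the assumption on \<open>Y l\<close>
  itself does not control the image. Stability rescues this: the image is that of the whole of some
  \<open>Y m\<close> under a bonding map, hence a factor of a system that has the property. In the
  lift, properties that speak only of return sets need nothing more than upward closure, whereas
  minimality needs closed images and specification needs a finite refinement of the cover, both
  supplied by compactness. The lift is formulated for families of factors rather than for inverse
  limits because the squares of the factors again form such a family; this takes care of weak
  mixing.\<close>

lemma dynamical_system_action_in:
  "dynamical_system G X \<Phi> \<Longrightarrow> g \<in> carrier G \<Longrightarrow> x \<in> topspace X \<Longrightarrow> \<Phi> g x \<in> topspace X"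
  unfolding dynamical_system_def using homeomorphic_imp_surjective_map[of X X "\<Phi> g"] by auto

section \<open>Factor maps and the properties expressed through return sets\<close>

definition factor_map ::
    "('g, 'm) monoid_scheme \<Rightarrow> 'a topology \<Rightarrow> ('g \<Rightarrow> 'a \<Rightarrow> 'a) \<Rightarrow>
     'b topology \<Rightarrow> ('g \<Rightarrow> 'b \<Rightarrow> 'b) \<Rightarrow> ('a \<Rightarrow> 'b) \<Rightarrow> bool" where
  "factor_map G X \<Phi> Y \<Psi> \<pi> \<longleftrightarrow>
     continuous_map X Y \<pi> \<and> \<pi> ` topspace X = topspace Y \<and>
     (\<forall>g\<in>carrier G. \<forall>x\<in>topspace X. \<Phi> g x \<in> topspace X \<and> \<pi> (\<Phi> g x) = \<Psi> g (\<pi> x))"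

text \<open>Transitivity, mixing and both forms of total transitivity, and weak mixing on the
  square, constrain \<open>U\<close> and \<open>V\<close> only through their return set. In all
  instances \<open>R\<close> is upward closed, which lets the property be lifted from
  factors.\<close>

definition return_property ::
    "('g set \<Rightarrow> bool) \<Rightarrow> ('g, 'm) monoid_scheme \<Rightarrow> 'a topology \<Rightarrow> ('g \<Rightarrow> 'a \<Rightarrow> 'a) \<Rightarrow> bool" where
  "return_property R G X \<Phi> \<longleftrightarrow>
     (\<forall>U V. openin X U \<and> openin X V \<and> U \<noteq> {} \<and> V \<noteq> {} \<longrightarrow> R (return_set G \<Phi> U V))"

lemma transitive_eq_return_property: "transitive_system = return_property infinite"
  by (intro ext) (auto simp: transitive_system_def return_property_def)

lemma mixing_eq_return_property:
  "mixing_system G = return_property (\<lambda>S. finite (carrier G - S)) G"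
  by (intro ext) (auto simp: mixing_system_def return_property_def)

lemma totally_transitive_eq_return_property:
  "totally_transitive_system G =
     return_property (\<lambda>S. \<forall>K. K \<subseteq> carrier G \<and> countable K \<longrightarrow> S \<inter> generate G K \<noteq> {}) G"
  unfolding totally_transitive_system_def return_property_def by (intro ext) meson

lemma totally_transitive_inf_eq_return_property:
  "totally_transitive_system_inf G =
     return_property
       (\<lambda>S. \<forall>K. K \<subseteq> carrier G \<and> countable K \<and> infinite K \<longrightarrow> S \<inter> generate G K \<noteq> {}) G"
  unfolding totally_transitive_system_inf_def return_property_def by (intro ext) meson

lemma return_set_mono:
  "U' \<subseteq> U \<Longrightarrow> V' \<subseteq> V \<Longrightarrow> return_set G \<Phi> U' V' \<subseteq> return_set G \<Phi> U V"
  by (auto simp: return_set_def)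

text \<open>\<open>\<pi>\<close> carries a witness upstairs to one below; a witness below lifts by
  surjectivity, and equivariance puts its translate into the preimage of \<open>U\<close>. Having
  equality makes this usable both for passing down to a factor and for lifting from it.\<close>

lemma return_set_preimage:
  assumes "group G" and f: "factor_map G X \<Phi> Y \<Psi> \<pi>"
    and U: "U \<subseteq> topspace Y" and V: "V \<subseteq> topspace Y"
  shows "return_set G \<Phi> {x \<in> topspace X. \<pi> x \<in> U} {x \<in> topspace X. \<pi> x \<in> V} = return_set G \<Psi> U V"
proof -
  have "{x \<in> topspace X. \<pi> x \<in> U} \<inter> \<Phi> (inv\<^bsub>G\<^esub> g) ` {x \<in> topspace X. \<pi> x \<in> V} \<noteq> {} \<longleftrightarrow>
        U \<inter> \<Psi> (inv\<^bsub>G\<^esub> g) ` V \<noteq> {}" (is "?l \<longleftrightarrow> ?r") if "g \<in> carrier G" for g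
  proof -
    have i: "inv\<^bsub>G\<^esub> g \<in> carrier G" using \<open>group G\<close> that by (simp add: group.inv_closed)
    show ?thesis
    proof
      assume ?l then show ?r using f i unfolding factor_map_def by auto
    next
      assume ?r
      then obtain v where v: "v \<in> V" "\<Psi> (inv\<^bsub>G\<^esub> g) v \<in> U" by auto
      then obtain x where "x \<in> topspace X" "v = \<pi> x"
        using f V unfolding factor_map_def by blast
      then have "\<Phi> (inv\<^bsub>G\<^esub> g) x \<in> {x \<in> topspace X. \<pi> x \<in> U} \<inter> \<Phi> (inv\<^bsub>G\<^esub> g) ` {x \<in> topspace X. \<pi> x \<in> V}"
        using f i v unfolding factor_map_def by auto
      then show ?l by blast
    qed
  qed
  then show ?thesis unfolding return_set_def by (intro Collect_cong conj_cong) auto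
qed

lemma factor_map_preimage_openin:
  "factor_map G X \<Phi> Y \<Psi> \<pi> \<Longrightarrow> openin Y U \<Longrightarrow> openin X {x \<in> topspace X. \<pi> x \<in> U}"
  unfolding factor_map_def by (elim conjE) (rule openin_continuous_map_preimage)

lemma factor_map_preimage_nonempty:
  assumes f: "factor_map G X \<Phi> Y \<Psi> \<pi>" and U: "U \<subseteq> topspace Y" "U \<noteq> {}"
  shows "{x \<in> topspace X. \<pi> x \<in> U} \<noteq> {}"
proof -
  obtain u where "u \<in> U" using U(2) by blast
  moreover from this have "u \<in> \<pi> ` topspace X" using U(1) f by (auto simp: factor_map_def)
  ultimately show ?thesis by blast
qed

lemma return_property_factor:
  assumes G: "group G" and f: "factor_map G X \<Phi> Y \<Psi> \<pi>" and R: "return_property R G X \<Phi>"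
  shows "return_property R G Y \<Psi>"
  unfolding return_property_def
proof (intro allI impI, elim conjE)
  fix U V assume U: "openin Y U" "U \<noteq> {}" and V: "openin Y V" "V \<noteq> {}"
  note s = openin_subset[OF U(1)] openin_subset[OF V(1)]
  have "R (return_set G \<Phi> {x \<in> topspace X. \<pi> x \<in> U} {x \<in> topspace X. \<pi> x \<in> V})"
    by (rule R[unfolded return_property_def, rule_format])
      (intro conjI factor_map_preimage_openin[OF f] factor_map_preimage_nonempty[OF f] U V s)
  then show "R (return_set G \<Psi> U V)" by (simp add: return_set_preimage[OF G f s])
qed

text \<open>Lets weak mixing, being transitivity of the square, pass down by the return set
  argument.\<close>

lemma factor_map_prod:
  assumes "factor_map G X \<Phi> Y \<Psi> \<pi>"
  shows "factor_map G (prod_topology X X) (\<lambda>g. map_prod (\<Phi> g) (\<Phi> g))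
           (prod_topology Y Y) (\<lambda>g. map_prod (\<Psi> g) (\<Psi> g)) (map_prod \<pi> \<pi>)"
proof -
  have "continuous_map (prod_topology X X) (prod_topology Y Y) (map_prod \<pi> \<pi>)"
    using assms unfolding map_prod_def by (simp add: factor_map_def continuous_map_prod_top)
  moreover have "map_prod \<pi> \<pi> ` topspace (prod_topology X X) = topspace (prod_topology Y Y)"
    using assms map_prod_surj_on[of \<pi> "topspace X" "topspace Y" \<pi> "topspace X" "topspace Y"]
    by (simp add: factor_map_def)
  ultimately show ?thesis using assms by (auto simp: factor_map_def)
qed

section \<open>Minimality and specification under factor maps\<close>

lemma minimal_system_factor:
  assumes f: "factor_map G X \<Phi> Y \<Psi> \<pi>" and m: "minimal_system G X \<Phi>"
  shows "minimal_system G Y \<Psi>"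
  unfolding minimal_system_def
proof (intro allI impI)
  fix C assume C: "closedin Y C \<and> C \<noteq> {} \<and> (\<forall>g\<in>carrier G. \<Psi> g ` C \<subseteq> C)"
  \<comment> \<open>The preimage of a closed invariant set is again closed and invariant, and
    nonempty by surjectivity, so minimality upstairs makes it everything.\<close>
  let ?D = "{x \<in> topspace X. \<pi> x \<in> C}"
  have "closedin X ?D" using f C closedin_continuous_map_preimage[of X Y \<pi> C] unfolding factor_map_def by simp
  moreover have "C \<subseteq> topspace Y" using C closedin_subset by blast
  moreover from this have "?D \<noteq> {}" using factor_map_preimage_nonempty[OF f] C by blast
  moreover have "\<forall>g\<in>carrier G. \<Phi> g ` ?D \<subseteq> ?D" using f C by (fastforce simp: factor_map_def)
  ultimately have "?D = topspace X" using m unfolding minimal_system_def by blast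
  moreover have "\<pi> ` topspace X = topspace Y" using f unfolding factor_map_def by blast
  ultimately have "topspace Y \<subseteq> C" by (metis (no_types, lifting) image_subsetI mem_Collect_eq)
  with \<open>C \<subseteq> topspace Y\<close> show "C = topspace Y" by blast
qed

text \<open>The tracing condition for one fixed \<open>F\<close> and one fixed family
  \<open>\<U>\<close>: it moves along a factor map in both directions with the same
  \<open>F\<close>, while the choice of covers is treated apart.\<close>

definition specifies ::
    "('g, 'm) monoid_scheme \<Rightarrow> 'a topology \<Rightarrow> ('g \<Rightarrow> 'a \<Rightarrow> 'a) \<Rightarrow> 'g set \<Rightarrow> 'a set set \<Rightarrow> bool" where
  "specifies G X \<Phi> F \<U> \<longleftrightarrow>
     (\<forall>(m::nat) (Fs :: nat \<Rightarrow> 'g set) (x :: nat \<Rightarrow> 'a).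
        m \<ge> 1 \<and>
        (\<forall>i\<in>{1..m}. finite (Fs i) \<and> Fs i \<subseteq> carrier G \<and> x i \<in> topspace X) \<and>
        (\<forall>i\<in>{1..m}. \<forall>j\<in>{1..m}. i \<noteq> j \<longrightarrow> (F <#>\<^bsub>G\<^esub> Fs i) \<inter> Fs j = {}) \<longrightarrow>
        (\<exists>y\<in>topspace X. \<forall>i\<in>{1..m}. \<forall>s\<in>Fs i. \<exists>U\<in>\<U>. \<Phi> s y \<in> U \<and> \<Phi> s (x i) \<in> U))"

lemma specification_property_alt:
  "specification_property G X \<Phi> \<longleftrightarrow>
     (\<forall>\<U>. finite \<U> \<and> (\<forall>U\<in>\<U>. openin X U) \<and> \<Union>\<U> = topspace X \<longrightarrow>
        (\<exists>F. finite F \<and> F \<noteq> {} \<and> F \<subseteq> carrier G \<and> specifies G X \<Phi> F \<U>))"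
  unfolding specification_property_def specifies_def by (rule refl)

text \<open>The points to be traced are lifted to \<open>X\<close>, traced there, and the tracing
  point is projected; closeness survives because each member of \<open>\<U>\<close> maps into a
  member of \<open>\<V>\<close>.\<close>

lemma specifies_factor:
  assumes f: "factor_map G X \<Phi> Y \<Psi> \<pi>" and sp: "specifies G X \<Phi> F \<U>"
    and ref: "\<And>U. U \<in> \<U> \<Longrightarrow> \<exists>V\<in>\<V>. \<pi> ` U \<subseteq> V"
  shows "specifies G Y \<Psi> F \<V>"
  unfolding specifies_def
proof (intro allI impI, elim conjE)
  fix m :: nat and Fs z
  assume m: "m \<ge> 1"
    and Fs: "\<forall>i\<in>{1..m}. finite (Fs i) \<and> Fs i \<subseteq> carrier G \<and> z i \<in> topspace Y"
    and sep: "\<forall>i\<in>{1..m}. \<forall>j\<in>{1..m}. i \<noteq> j \<longrightarrow> (F <#>\<^bsub>G\<^esub> Fs i) \<inter> Fs j = {}"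
  have "\<forall>i\<in>{1..m}. \<exists>x\<in>topspace X. \<pi> x = z i"
    using Fs f unfolding factor_map_def by (metis imageE)
  then obtain x where x: "\<forall>i\<in>{1..m}. x i \<in> topspace X \<and> \<pi> (x i) = z i"
    by metis
  have "\<forall>i\<in>{1..m}. finite (Fs i) \<and> Fs i \<subseteq> carrier G \<and> x i \<in> topspace X"
    using Fs x by simp
  with sp m sep have "\<exists>y\<in>topspace X. \<forall>i\<in>{1..m}. \<forall>s\<in>Fs i. \<exists>U\<in>\<U>. \<Phi> s y \<in> U \<and> \<Phi> s (x i) \<in> U"
    unfolding specifies_def by simp
  then obtain y where y: "y \<in> topspace X"
    "\<forall>i\<in>{1..m}. \<forall>s\<in>Fs i. \<exists>U\<in>\<U>. \<Phi> s y \<in> U \<and> \<Phi> s (x i) \<in> U" by (rule bexE)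
  show "\<exists>y\<in>topspace Y. \<forall>i\<in>{1..m}. \<forall>s\<in>Fs i. \<exists>U\<in>\<V>. \<Psi> s y \<in> U \<and> \<Psi> s (z i) \<in> U"
  proof (intro bexI[of _ "\<pi> y"] ballI)
    fix i s assume i: "i \<in> {1..m}" and s: "s \<in> Fs i"
    then obtain U where U: "U \<in> \<U>" "\<Phi> s y \<in> U" "\<Phi> s (x i) \<in> U" using y(2) by blast
    obtain V where V: "V \<in> \<V>" "\<pi> ` U \<subseteq> V" using ref[OF U(1)] by blast
    have "s \<in> carrier G" using Fs i s by blast
    then have "\<pi> (\<Phi> s y) = \<Psi> s (\<pi> y)" "\<pi> (\<Phi> s (x i)) = \<Psi> s (z i)"
      using f y(1) x i unfolding factor_map_def by auto
    with U V show "\<exists>U\<in>\<V>. \<Psi> s (\<pi> y) \<in> U \<and> \<Psi> s (z i) \<in> U" by (metis image_subset_iff)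
  qed (use y(1) f in \<open>auto simp: factor_map_def\<close>)
qed

text \<open>Any \<open>y\<close> above a tracing point \<open>z\<close> works: by
  \<open>ref\<close>, it is enough to know which member of \<open>\<V>\<close> contains the image of
  \<open>\<Phi> s y\<close>, and that image is \<open>\<Psi> s z\<close>.\<close>

lemma specifies_lift:
  assumes f: "factor_map G X \<Phi> Y \<Psi> \<pi>" and sp: "specifies G Y \<Psi> F \<V>"
    and ref: "\<And>V. V \<in> \<V> \<Longrightarrow> \<exists>U\<in>\<U>. {x \<in> topspace X. \<pi> x \<in> V} \<subseteq> U"
  shows "specifies G X \<Phi> F \<U>"
  unfolding specifies_def
proof (intro allI impI, elim conjE)
  fix m :: nat and Fs x
  assume m: "m \<ge> 1"
    and Fs: "\<forall>i\<in>{1..m}. finite (Fs i) \<and> Fs i \<subseteq> carrier G \<and> x i \<in> topspace X"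
    and sep: "\<forall>i\<in>{1..m}. \<forall>j\<in>{1..m}. i \<noteq> j \<longrightarrow> (F <#>\<^bsub>G\<^esub> Fs i) \<inter> Fs j = {}"
  have "\<forall>i\<in>{1..m}. finite (Fs i) \<and> Fs i \<subseteq> carrier G \<and> \<pi> (x i) \<in> topspace Y"
    using Fs f unfolding factor_map_def by blast
  with sp m sep
  have "\<exists>z\<in>topspace Y. \<forall>i\<in>{1..m}. \<forall>s\<in>Fs i. \<exists>V\<in>\<V>. \<Psi> s z \<in> V \<and> \<Psi> s (\<pi> (x i)) \<in> V"
    unfolding specifies_def by (elim allE[of _ m] allE[of _ Fs] allE[of _ "\<lambda>i. \<pi> (x i)"]) simp
  then obtain z where z: "z \<in> topspace Y"
    "\<forall>i\<in>{1..m}. \<forall>s\<in>Fs i. \<exists>V\<in>\<V>. \<Psi> s z \<in> V \<and> \<Psi> s (\<pi> (x i)) \<in> V" by (rule bexE)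
  obtain y where y: "y \<in> topspace X" "z = \<pi> y" using z(1) f unfolding factor_map_def by blast
  show "\<exists>y\<in>topspace X. \<forall>i\<in>{1..m}. \<forall>s\<in>Fs i. \<exists>U\<in>\<U>. \<Phi> s y \<in> U \<and> \<Phi> s (x i) \<in> U"
  proof (intro bexI[of _ y] ballI)
    fix i s assume i: "i \<in> {1..m}" and s: "s \<in> Fs i"
    then obtain V where V: "V \<in> \<V>" "\<Psi> s z \<in> V" "\<Psi> s (\<pi> (x i)) \<in> V" using z(2) by blast
    obtain U where U: "U \<in> \<U>" "{x \<in> topspace X. \<pi> x \<in> V} \<subseteq> U" using ref[OF V(1)] by blast
    have "s \<in> carrier G" "x i \<in> topspace X" using Fs i s by blast+
    then have "\<Phi> s y \<in> {x \<in> topspace X. \<pi> x \<in> V}" "\<Phi> s (x i) \<in> {x \<in> topspace X. \<pi> x \<in> V}"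
      using f y V(2,3) unfolding factor_map_def by auto
    with U show "\<exists>U\<in>\<U>. \<Phi> s y \<in> U \<and> \<Phi> s (x i) \<in> U" by blast
  qed (rule y(1))
qed

lemma specification_property_factor:
  assumes f: "factor_map G X \<Phi> Y \<Psi> \<pi>" and sp: "specification_property G X \<Phi>"
  shows "specification_property G Y \<Psi>"
  unfolding specification_property_alt
proof (intro allI impI)
  fix \<V> assume V: "finite \<V> \<and> (\<forall>V\<in>\<V>. openin Y V) \<and> \<Union>\<V> = topspace Y"
  let ?U = "(\<lambda>V. {x \<in> topspace X. \<pi> x \<in> V}) ` \<V>"
  have "finite ?U" "\<forall>U\<in>?U. openin X U" using V factor_map_preimage_openin[OF f] by auto
  moreover have "\<Union>?U = topspace X" using V f unfolding factor_map_def by blast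
  ultimately obtain F where "finite F \<and> F \<noteq> {} \<and> F \<subseteq> carrier G" "specifies G X \<Phi> F ?U"
    using sp unfolding specification_property_alt by meson
  moreover have "specifies G Y \<Psi> F \<V>" if "specifies G X \<Phi> F ?U"
    by (rule specifies_factor[OF f that]) auto
  ultimately show "\<exists>F. finite F \<and> F \<noteq> {} \<and> F \<subseteq> carrier G \<and> specifies G Y \<Psi> F \<V>" by blast
qed

lemma has_property_factor:
  assumes G: "group G" and f: "factor_map G X \<Phi> Y \<Psi> \<pi>" and P: "has_property P G X \<Phi>"
  shows "has_property P G Y \<Psi>"
  using P return_property_factor[OF G f] return_property_factor[OF G factor_map_prod[OF f]]
    minimal_system_factor[OF f] specification_property_factor[OF f]
  by (cases P) (simp_all add: has_property_def weakly_mixing_system_def transitive_eq_return_property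
      mixing_eq_return_property totally_transitive_eq_return_property
      totally_transitive_inf_eq_return_property)

section \<open>Lifting properties from approximating factors\<close>

definition pulled_back_open :: "'a topology \<Rightarrow> 'b topology \<Rightarrow> ('a \<Rightarrow> 'b) \<Rightarrow> 'a set \<Rightarrow> bool" where
  "pulled_back_open X Z \<pi> W \<longleftrightarrow> (\<exists>B. openin Z B \<and> W = {x \<in> topspace X. \<pi> x \<in> B})"

text \<open>Preimages commute with unions. Taking the union of all open \<open>B\<close> whose
  preimage lies in \<open>W\<close> avoids choosing one \<open>B\<close> for each point.\<close>

lemma pulled_back_open_local:
  assumes loc: "\<And>x. x \<in> W \<Longrightarrow> \<exists>W'. pulled_back_open X Z \<pi> W' \<and> x \<in> W' \<and> W' \<subseteq> W"
  shows "pulled_back_open X Z \<pi> W"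
proof -
  let ?\<B> = "{B. openin Z B \<and> {x \<in> topspace X. \<pi> x \<in> B} \<subseteq> W}"
  have "W \<subseteq> {x \<in> topspace X. \<pi> x \<in> \<Union>?\<B>}"
  proof
    fix x assume "x \<in> W"
    then obtain B where "openin Z B" "x \<in> {x \<in> topspace X. \<pi> x \<in> B}" "{x \<in> topspace X. \<pi> x \<in> B} \<subseteq> W"
      using loc unfolding pulled_back_open_def by metis
    then show "x \<in> {x \<in> topspace X. \<pi> x \<in> \<Union>?\<B>}" by auto
  qed
  then have "W = {x \<in> topspace X. \<pi> x \<in> \<Union>?\<B>}" by auto
  moreover have "openin Z (\<Union>?\<B>)" by auto
  ultimately show ?thesis unfolding pulled_back_open_def by (intro exI[of _ "\<Union>?\<B>"] conjI)
qed

text \<open>The factors are compared only through the families of subsets of \<open>X\<close> that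
  they pull back, without maps between them. This keeps the notion stable under squaring with the
  same index set, as weak mixing requires.\<close>

locale approximating_factors =
  fixes G :: "('g, 'm) monoid_scheme"
    and X :: "'a topology" and \<Phi> :: "'g \<Rightarrow> 'a \<Rightarrow> 'a"
    and L :: "'i set"
    and Z :: "'i \<Rightarrow> 'b topology" and \<Psi> :: "'i \<Rightarrow> 'g \<Rightarrow> 'b \<Rightarrow> 'b" and \<pi> :: "'i \<Rightarrow> 'a \<Rightarrow> 'b"
  assumes grp: "group G"
    and factor: "l \<in> L \<Longrightarrow> factor_map G X \<Phi> (Z l) (\<Psi> l) (\<pi> l)"
    and nonempty: "L \<noteq> {}"
    and directed: "a \<in> L \<Longrightarrow> b \<in> L \<Longrightarrow> \<exists>c\<in>L. \<forall>W.
        pulled_back_open X (Z a) (\<pi> a) W \<or> pulled_back_open X (Z b) (\<pi> b) W \<longrightarrow>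
        pulled_back_open X (Z c) (\<pi> c) W"
    and base: "openin X U \<Longrightarrow> x \<in> U \<Longrightarrow>
        \<exists>l\<in>L. \<exists>W. pulled_back_open X (Z l) (\<pi> l) W \<and> x \<in> W \<and> W \<subseteq> U"
begin

text \<open>Serves to place a finite subcover over a single factor.\<close>

lemma finite_directed:
  assumes "finite \<W>" "\<And>W. W \<in> \<W> \<Longrightarrow> \<exists>l\<in>L. pulled_back_open X (Z l) (\<pi> l) W"
  shows "\<exists>l\<in>L. \<forall>W\<in>\<W>. pulled_back_open X (Z l) (\<pi> l) W"
  using assms
proof (induction \<W>)
  case empty then show ?case using nonempty by blast
next
  case (insert W \<W>)
  then obtain a where a: "a \<in> L" "\<forall>W\<in>\<W>. pulled_back_open X (Z a) (\<pi> a) W" by blast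
  obtain b where b: "b \<in> L" "pulled_back_open X (Z b) (\<pi> b) W" using insert.prems by blast
  obtain c where "c \<in> L" "\<forall>W. pulled_back_open X (Z a) (\<pi> a) W \<or>
        pulled_back_open X (Z b) (\<pi> b) W \<longrightarrow> pulled_back_open X (Z c) (\<pi> c) W"
    using directed[OF a(1) b(1)] by blast
  then show ?case using a b by blast
qed

text \<open>A basic set around a point of \<open>U\<close> and one around a point of
  \<open>V\<close> may come from different factors; \<open>directed\<close> moves both to a common
  one.\<close>

lemma two_open_sets:
  assumes U: "openin X U" "U \<noteq> {}" and V: "openin X V" "V \<noteq> {}"
  obtains l U' V' where "l \<in> L" "openin (Z l) U'" "openin (Z l) V'" "U' \<noteq> {}" "V' \<noteq> {}"
    "{x \<in> topspace X. \<pi> l x \<in> U'} \<subseteq> U" "{x \<in> topspace X. \<pi> l x \<in> V'} \<subseteq> V"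
proof -
  obtain u v where uv: "u \<in> U" "v \<in> V" using U V by blast
  obtain a W where a: "a \<in> L" "pulled_back_open X (Z a) (\<pi> a) W" "u \<in> W" "W \<subseteq> U"
    using base[OF U(1) uv(1)] by blast
  obtain b W' where b: "b \<in> L" "pulled_back_open X (Z b) (\<pi> b) W'" "v \<in> W'" "W' \<subseteq> V"
    using base[OF V(1) uv(2)] by blast
  obtain l where l: "l \<in> L" "pulled_back_open X (Z l) (\<pi> l) W" "pulled_back_open X (Z l) (\<pi> l) W'"
    using directed[OF a(1) b(1)] a(2) b(2) by blast
  then obtain U' V' where "openin (Z l) U'" "W = {x \<in> topspace X. \<pi> l x \<in> U'}"
    "openin (Z l) V'" "W' = {x \<in> topspace X. \<pi> l x \<in> V'}"
    unfolding pulled_back_open_def by blast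
  with l a b that[of l U' V'] show thesis by blast
qed

text \<open>Shrinking \<open>U\<close> and \<open>V\<close> to preimages from one factor shrinks the
  return set to a return set of that factor, which satisfies \<open>R\<close>; \<open>mono\<close>
  leads back to the original sets.\<close>

lemma return_property_lift:
  assumes R: "\<And>l. l \<in> L \<Longrightarrow> return_property R G (Z l) (\<Psi> l)"
    and mono: "\<And>S T. R S \<Longrightarrow> S \<subseteq> T \<Longrightarrow> R T"
  shows "return_property R G X \<Phi>"
  unfolding return_property_def
proof (intro allI impI, elim conjE)
  fix U V assume U: "openin X U" "U \<noteq> {}" and V: "openin X V" "V \<noteq> {}"
  obtain l U' V' where l: "l \<in> L" "openin (Z l) U'" "openin (Z l) V'" "U' \<noteq> {}" "V' \<noteq> {}"
    "{x \<in> topspace X. \<pi> l x \<in> U'} \<subseteq> U" "{x \<in> topspace X. \<pi> l x \<in> V'} \<subseteq> V"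
    by (rule two_open_sets[OF U V])
  have "R (return_set G (\<Psi> l) U' V')"
    using R[OF l(1), unfolded return_property_def] l(2-5) by simp
  moreover have "return_set G (\<Psi> l) U' V' \<subseteq> return_set G \<Phi> U V"
    using return_set_preimage[OF grp factor[OF l(1)] openin_subset[OF l(2)] openin_subset[OF l(3)]]
      return_set_mono[OF l(6,7)] by metis
  ultimately show "R (return_set G \<Phi> U V)" by (rule mono)
qed

text \<open>A point missed by \<open>C\<close> would be separated from \<open>C\<close> by a set
  \<open>W\<close> pulled back from one factor. But the image of \<open>C\<close> there is closed,
  nonempty and invariant, hence everything, so some point of \<open>C\<close> lies in the fibre of
  the missed point. As \<open>W\<close> is a union of fibres, this is a contradiction.\<close>

lemma minimal_lift:
  assumes X: "compact_space X" and H: "\<And>l. l \<in> L \<Longrightarrow> Hausdorff_space (Z l)"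
    and m: "\<And>l. l \<in> L \<Longrightarrow> minimal_system G (Z l) (\<Psi> l)"
  shows "minimal_system G X \<Phi>"
  unfolding minimal_system_def
proof (intro allI impI)
  fix C assume C: "closedin X C \<and> C \<noteq> {} \<and> (\<forall>g\<in>carrier G. \<Phi> g ` C \<subseteq> C)"
  then have CX: "C \<subseteq> topspace X" by (simp add: closedin_subset)
  have "x \<in> C" if x: "x \<in> topspace X" for x
  proof (rule ccontr)
    assume "x \<notin> C"
    then obtain l W where l: "l \<in> L" "pulled_back_open X (Z l) (\<pi> l) W" "x \<in> W" "W \<subseteq> topspace X - C"
      using base[of "topspace X - C" x] C x by blast
    have f: "continuous_map X (Z l) (\<pi> l)" "\<pi> l ` topspace X = topspace (Z l)"
      "\<And>g x. g \<in> carrier G \<Longrightarrow> x \<in> topspace X \<Longrightarrow> \<pi> l (\<Phi> g x) = \<Psi> l g (\<pi> l x)"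
      using factor[OF l(1)] unfolding factor_map_def by auto
    have "closedin (Z l) (\<pi> l ` C)"
      using T1_Spaces.continuous_imp_closed_map[OF f(1) X H[OF l(1)]] C unfolding closed_map_def by blast
    moreover have "\<pi> l ` C \<noteq> {}" using C by simp
    moreover have "\<forall>g\<in>carrier G. \<Psi> l g ` \<pi> l ` C \<subseteq> \<pi> l ` C"
    proof (intro ballI image_subsetI)
      fix g z assume g: "g \<in> carrier G" and "z \<in> \<pi> l ` C"
      then obtain c where c: "c \<in> C" "z = \<pi> l c" by auto
      then have "\<Phi> g c \<in> C" using C g by (meson image_subset_iff)
      moreover have "\<Psi> l g z = \<pi> l (\<Phi> g c)" using c CX f(3)[OF g] by (simp add: subsetD)
      ultimately show "\<Psi> l g z \<in> \<pi> l ` C" by (simp only: imageI)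
    qed
    ultimately have "\<pi> l ` C = topspace (Z l)"
      using m[OF l(1), unfolded minimal_system_def, rule_format] by simp
    then have "\<pi> l x \<in> \<pi> l ` C" using f(2) x by auto
    then obtain c where "c \<in> C" "\<pi> l c = \<pi> l x" by auto
    moreover obtain B where "W = {x \<in> topspace X. \<pi> l x \<in> B}"
      using l(2) unfolding pulled_back_open_def by auto
    ultimately have "c \<in> W" using l(3) CX by auto
    with l(4) \<open>c \<in> C\<close> show False by auto
  qed
  with CX show "C = topspace X" by blast
qed

lemma specification_lift:
  assumes X: "compact_space X"
    and sp: "\<And>l. l \<in> L \<Longrightarrow> specification_property G (Z l) (\<Psi> l)"
  shows "specification_property G X \<Phi>"
  unfolding specification_property_alt
proof (intro allI impI, elim conjE)
  fix \<U> assume U: "\<forall>U\<in>\<U>. openin X U" "\<Union>\<U> = topspace X"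
  \<comment> \<open>All pulled-back sets subordinate to the given cover, from all factors at once.
    They cover \<open>X\<close> by \<open>base\<close>; compactness and directedness then leave
    finitely many, over one factor.\<close>
  define \<B> where "\<B> = {W. (\<exists>l\<in>L. pulled_back_open X (Z l) (\<pi> l) W) \<and> (\<exists>U\<in>\<U>. W \<subseteq> U)}"
  have "openin X W" if "W \<in> \<B>" for W
  proof -
    obtain l where l: "l \<in> L" "pulled_back_open X (Z l) (\<pi> l) W"
      using \<open>W \<in> \<B>\<close> unfolding \<B>_def by auto
    then obtain B where "openin (Z l) B" "W = {x \<in> topspace X. \<pi> l x \<in> B}"
      unfolding pulled_back_open_def by auto
    with factor_map_preimage_openin[OF factor[OF l(1)]] show ?thesis by simp
  qed
  moreover have "topspace X \<subseteq> \<Union>\<B>"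
  proof
    fix x assume "x \<in> topspace X"
    then obtain U where "U \<in> \<U>" "x \<in> U" using U(2) by auto
    moreover from this obtain l W
      where "l \<in> L" "pulled_back_open X (Z l) (\<pi> l) W" "x \<in> W" "W \<subseteq> U"
      using base[of U x] U(1) by auto
    ultimately show "x \<in> \<Union>\<B>" unfolding \<B>_def by auto
  qed
  ultimately obtain \<W> where W: "finite \<W>" "\<W> \<subseteq> \<B>" "topspace X \<subseteq> \<Union>\<W>"
    using X[unfolded compact_space_alt, rule_format, of \<B>] by auto
  have "\<exists>l\<in>L. pulled_back_open X (Z l) (\<pi> l) W" if "W \<in> \<W>" for W
    using that W(2) unfolding \<B>_def by auto
  then obtain l where l: "l \<in> L" "\<And>W. W \<in> \<W> \<Longrightarrow> pulled_back_open X (Z l) (\<pi> l) W"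
    using finite_directed[OF W(1)] by auto
  have f: "\<pi> l ` topspace X = topspace (Z l)" using factor[OF l(1)] unfolding factor_map_def by auto
  \<comment> \<open>\<open>\<pi> l\<close> need not be an open map, but each \<open>W\<close> is the
    full preimage of an open \<open>B\<close>, so by surjectivity its image is
    \<open>B\<close>.\<close>
  have im: "openin (Z l) (\<pi> l ` W)" "{x \<in> topspace X. \<pi> l x \<in> \<pi> l ` W} = W" if w: "W \<in> \<W>" for W
  proof -
    obtain B where B: "openin (Z l) B" "W = {x \<in> topspace X. \<pi> l x \<in> B}"
      using l(2)[OF w] unfolding pulled_back_open_def by auto
    have "B \<subseteq> \<pi> l ` topspace X" using f openin_subset[OF B(1)] by simp
    then have "\<pi> l ` W = B" unfolding B(2) by auto
    with B show "openin (Z l) (\<pi> l ` W)" "{x \<in> topspace X. \<pi> l x \<in> \<pi> l ` W} = W" by simp_all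
  qed
  let ?V = "(\<lambda>W. \<pi> l ` W) ` \<W>"
  have "\<Union>\<W> = topspace X"
    using W(3) im(2) by auto
  then have "\<Union>?V = topspace (Z l)" using f by (simp flip: image_Union)
  moreover have "finite ?V" "\<forall>V\<in>?V. openin (Z l) V" using W(1) im(1) by auto
  ultimately obtain F where F: "finite F \<and> F \<noteq> {} \<and> F \<subseteq> carrier G \<and> specifies G (Z l) (\<Psi> l) F ?V"
    using sp[OF l(1), unfolded specification_property_alt, rule_format, of ?V] by auto
  have "\<exists>U\<in>\<U>. {x \<in> topspace X. \<pi> l x \<in> V} \<subseteq> U" if V: "V \<in> ?V" for V
  proof -
    obtain W where w: "W \<in> \<W>" "V = \<pi> l ` W" using V by auto
    moreover have "\<exists>U\<in>\<U>. W \<subseteq> U" using w(1) W(2) unfolding \<B>_def by auto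
    ultimately show ?thesis using im(2)[OF w(1)] by simp
  qed
  then have "specifies G X \<Phi> F \<U>" using F by (intro specifies_lift[OF factor[OF l(1)]]) auto
  with F show "\<exists>F. finite F \<and> F \<noteq> {} \<and> F \<subseteq> carrier G \<and> specifies G X \<Phi> F \<U>" by auto
qed

lemma approximating_factors_prod:
  "approximating_factors G (prod_topology X X) (\<lambda>g. map_prod (\<Phi> g) (\<Phi> g)) L
     (\<lambda>l. prod_topology (Z l) (Z l)) (\<lambda>l g. map_prod (\<Psi> l g) (\<Psi> l g))
     (\<lambda>l. map_prod (\<pi> l) (\<pi> l))"
proof (rule approximating_factors.intro)
  show "group G" by (rule grp)
  show "L \<noteq> {}" by (rule nonempty)
  show "factor_map G (prod_topology X X) (\<lambda>g. map_prod (\<Phi> g) (\<Phi> g)) (prod_topology (Z l) (Z l))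
      (\<lambda>g. map_prod (\<Psi> l g) (\<Psi> l g)) (map_prod (\<pi> l) (\<pi> l))" if "l \<in> L" for l
    by (rule factor_map_prod[OF factor[OF that]])
next
  let ?P = "\<lambda>l. pulled_back_open (prod_topology X X) (prod_topology (Z l) (Z l)) (map_prod (\<pi> l) (\<pi> l))"
  have rect: "?P l (W \<times> W')"
    if W: "pulled_back_open X (Z l) (\<pi> l) W" and W': "pulled_back_open X (Z l) (\<pi> l) W'" for l W W'
  proof -
    obtain B where B: "openin (Z l) B" "W = {x \<in> topspace X. \<pi> l x \<in> B}"
      using W unfolding pulled_back_open_def by auto
    obtain B' where B': "openin (Z l) B'" "W' = {x \<in> topspace X. \<pi> l x \<in> B'}"
      using W' unfolding pulled_back_open_def by auto
    have eq: "W \<times> W' = {p \<in> topspace (prod_topology X X). map_prod (\<pi> l) (\<pi> l) p \<in> B \<times> B'}"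
      unfolding B(2) B'(2) by auto
    have "openin (prod_topology (Z l) (Z l)) (B \<times> B')"
      using B(1) B'(1) by (simp add: openin_prod_Times_iff)
    with eq show ?thesis unfolding pulled_back_open_def by (intro exI[of _ "B \<times> B'"] conjI)
  qed
  show "\<exists>c\<in>L. \<forall>W. ?P a W \<or> ?P b W \<longrightarrow> ?P c W" if a: "a \<in> L" and b: "b \<in> L" for a b
  proof -
    obtain c where c: "c \<in> L" "\<forall>W. pulled_back_open X (Z a) (\<pi> a) W \<or>
        pulled_back_open X (Z b) (\<pi> b) W \<longrightarrow> pulled_back_open X (Z c) (\<pi> c) W"
      using directed[OF a b] by auto
    \<comment> \<open>A set pulled back from the square of the factor \<open>d\<close> need not be a
      rectangle, whereas \<open>directed\<close> speaks of single coordinates only. So it is split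
      locally into rectangles, which are moved to \<open>c\<close> and glued. Letting
      \<open>d\<close> range over \<open>{a, b}\<close> treats both factors at once.\<close>
    have "?P c W" if W: "?P d W" and d: "d \<in> {a, b}" for d W
    proof (rule pulled_back_open_local)
      fix p assume p: "p \<in> W"
      obtain x y where xy: "p = (x, y)" by (cases p)
      obtain B where B: "openin (prod_topology (Z d) (Z d)) B"
        "W = {p \<in> topspace (prod_topology X X). map_prod (\<pi> d) (\<pi> d) p \<in> B}"
        using W unfolding pulled_back_open_def by auto
      have B': "(\<pi> d x, \<pi> d y) \<in> B" "x \<in> topspace X" "y \<in> topspace X" using p B(2) xy by auto
      obtain V V' where V: "openin (Z d) V" "openin (Z d) V'" "\<pi> d x \<in> V" "\<pi> d y \<in> V'" "V \<times> V' \<subseteq> B"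
        using B(1) B'(1) unfolding openin_prod_topology_alt by metis
      let ?W = "{x \<in> topspace X. \<pi> d x \<in> V}" and ?W' = "{x \<in> topspace X. \<pi> d x \<in> V'}"
      have "pulled_back_open X (Z d) (\<pi> d) ?W" "pulled_back_open X (Z d) (\<pi> d) ?W'"
        using V(1,2) unfolding pulled_back_open_def by auto
      then have "?P c (?W \<times> ?W')" using c(2) d by (intro rect) auto
      moreover have "p \<in> ?W \<times> ?W'" "?W \<times> ?W' \<subseteq> W" using B' V(3-5) xy B(2) by auto
      ultimately show "\<exists>W'. ?P c W' \<and> p \<in> W' \<and> W' \<subseteq> W" by auto
    qed
    with c(1) show ?thesis by auto
  qed
  show "\<exists>l\<in>L. \<exists>W. ?P l W \<and> p \<in> W \<and> W \<subseteq> U" if U: "openin (prod_topology X X) U" and p: "p \<in> U" for U p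
  proof -
    obtain x y where xy: "p = (x, y)" by (cases p)
    then obtain V V' where V: "openin X V" "openin X V'" "x \<in> V" "y \<in> V'" "V \<times> V' \<subseteq> U"
      using U p unfolding openin_prod_topology_alt by metis
    obtain a W where a: "a \<in> L" "pulled_back_open X (Z a) (\<pi> a) W" "x \<in> W" "W \<subseteq> V"
      using base[OF V(1,3)] by auto
    obtain b W' where b: "b \<in> L" "pulled_back_open X (Z b) (\<pi> b) W'" "y \<in> W'" "W' \<subseteq> V'"
      using base[OF V(2,4)] by auto
    obtain l where l: "l \<in> L"
      "pulled_back_open X (Z l) (\<pi> l) W" "pulled_back_open X (Z l) (\<pi> l) W'"
      using directed[OF a(1) b(1)] a(2) b(2) by auto
    have "p \<in> W \<times> W'" "W \<times> W' \<subseteq> U"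
      using a(3,4) b(3,4) V(5) xy by auto
    with l(1) rect[OF l(2,3)] show ?thesis by (intro bexI[of _ l] exI[of _ "W \<times> W'"] conjI)
  qed
qed

lemma has_property_lift:
  assumes X: "compact_space X" and H: "\<And>l. l \<in> L \<Longrightarrow> Hausdorff_space (Z l)"
    and P: "\<And>l. l \<in> L \<Longrightarrow> has_property P G (Z l) (\<Psi> l)"
  shows "has_property P G X \<Phi>"
proof (cases P)
  case Transitivity
  have "return_property infinite G X \<Phi>"
  proof (rule return_property_lift)
    show "return_property infinite G (Z l) (\<Psi> l)" if "l \<in> L" for l
      using P[OF that] Transitivity by (simp add: has_property_def transitive_eq_return_property)
  qed (rule infinite_super)
  then show ?thesis using Transitivity by (simp add: has_property_def transitive_eq_return_property)
next
  case Minimality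
  have "minimal_system G X \<Phi>"
  proof (rule minimal_lift[OF X H])
    show "minimal_system G (Z l) (\<Psi> l)" if "l \<in> L" for l
      using P[OF that] Minimality by (simp add: has_property_def)
  qed
  then show ?thesis using Minimality by (simp add: has_property_def)
next
  case Total_Transitivity
  have "totally_transitive_system G X \<Phi>"
    unfolding totally_transitive_eq_return_property
  proof (rule return_property_lift)
    show "return_property (\<lambda>S. \<forall>K. K \<subseteq> carrier G \<and> countable K \<longrightarrow> S \<inter> generate G K \<noteq> {})
        G (Z l) (\<Psi> l)" if "l \<in> L" for l
      using P[OF that] Total_Transitivity
      by (simp add: has_property_def totally_transitive_eq_return_property)
  qed blast
  then show ?thesis using Total_Transitivity by (simp add: has_property_def)
next
  case Total_Transitivity_Inf
  have "totally_transitive_system_inf G X \<Phi>"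
    unfolding totally_transitive_inf_eq_return_property
  proof (rule return_property_lift)
    show "return_property
        (\<lambda>S. \<forall>K. K \<subseteq> carrier G \<and> countable K \<and> infinite K \<longrightarrow> S \<inter> generate G K \<noteq> {})
        G (Z l) (\<Psi> l)" if "l \<in> L" for l
      using P[OF that] Total_Transitivity_Inf
      by (simp add: has_property_def totally_transitive_inf_eq_return_property)
  qed blast
  then show ?thesis using Total_Transitivity_Inf by (simp add: has_property_def)
next
  case Weak_Mixing
  have "return_property infinite G (prod_topology X X) (\<lambda>g. map_prod (\<Phi> g) (\<Phi> g))"
  proof (rule approximating_factors.return_property_lift[OF approximating_factors_prod])
    show "return_property infinite G (prod_topology (Z l) (Z l)) (\<lambda>g. map_prod (\<Psi> l g) (\<Psi> l g))"
      if "l \<in> L" for l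
      using P[OF that] Weak_Mixing
      by (simp add: has_property_def weakly_mixing_system_def transitive_eq_return_property)
  qed (rule infinite_super)
  then show ?thesis using Weak_Mixing
    by (simp add: has_property_def weakly_mixing_system_def transitive_eq_return_property)
next
  case Mixing
  have "mixing_system G X \<Phi>"
    unfolding mixing_eq_return_property
  proof (rule return_property_lift)
    show "return_property (\<lambda>S. finite (carrier G - S)) G (Z l) (\<Psi> l)" if "l \<in> L" for l
      using P[OF that] Mixing by (simp add: has_property_def mixing_eq_return_property)
    show "finite (carrier G - T)" if "finite (carrier G - S)" "S \<subseteq> T" for S T
      by (rule finite_subset[OF _ that(1)]) (use that(2) in auto)
  qed
  then show ?thesis using Mixing by (simp add: has_property_def)
next
  case Specification
  have "specification_property G X \<Phi>"
  proof (rule specification_lift[OF X])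
    show "specification_property G (Z l) (\<Psi> l)" if "l \<in> L" for l
      using P[OF that] Specification by (simp add: has_property_def)
  qed
  then show ?thesis using Specification by (simp add: has_property_def)
qed

end

section \<open>Inverse limits\<close>

text \<open>By directedness every finite intersection contains a single nonempty \<open>D c\<close>,
  so the finite intersection property applies. Used to build threads in the product and to find a
  point of \<open>X\<close> over a given thread.\<close>

lemma compact_space_directed_Inter:
  assumes X: "compact_space X" and I: "I \<noteq> {}"
    and closed: "\<And>i. i \<in> I \<Longrightarrow> closedin X (D i)" and ne: "\<And>i. i \<in> I \<Longrightarrow> D i \<noteq> {}"
    and dir: "\<And>a b. a \<in> I \<Longrightarrow> b \<in> I \<Longrightarrow> \<exists>c\<in>I. D c \<subseteq> D a \<inter> D b"
  shows "(\<Inter>i\<in>I. D i) \<noteq> {}"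
proof -
  have "\<exists>c\<in>I. D c \<subseteq> (\<Inter>i\<in>J. D i)" if "finite J" "J \<subseteq> I" for J
    using that
  proof (induction J)
    case empty
    then show ?case using I by auto
  next
    case (insert j J)
    then obtain c where c: "c \<in> I" "D c \<subseteq> (\<Inter>i\<in>J. D i)" by auto
    moreover obtain d where "d \<in> I" "D d \<subseteq> D c \<inter> D j" using dir[OF c(1), of j] insert.prems by auto
    ultimately show ?case by (intro bexI[of _ d]) auto
  qed
  then have "\<Inter>\<F> \<noteq> {}" if "finite \<F>" "\<F> \<subseteq> D ` I" for \<F>
    using that ne by (metis finite_subset_image subset_empty)
  moreover have "\<forall>C\<in>D ` I. closedin X C" using closed by auto
  ultimately show ?thesis using X[unfolded compact_space_fip, rule_format, of "D ` I"] by simp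
qed

lemma directed_setD:
  assumes "directed_set \<Lambda> leq"
  shows "\<Lambda> \<noteq> {}" and "a \<in> \<Lambda> \<Longrightarrow> leq a a"
    and "\<lbrakk>a \<in> \<Lambda>; b \<in> \<Lambda>; c \<in> \<Lambda>; leq a b; leq b c\<rbrakk> \<Longrightarrow> leq a c"
    and "\<lbrakk>a \<in> \<Lambda>; b \<in> \<Lambda>\<rbrakk> \<Longrightarrow> \<exists>c\<in>\<Lambda>. leq a c \<and> leq b c"
  using assms[unfolded directed_set_def] by meson+

lemma directed_set_finite_upper_bound:
  assumes L: "directed_set \<Lambda> leq" and J: "finite J" "J \<subseteq> \<Lambda>"
  shows "\<exists>c\<in>\<Lambda>. \<forall>j\<in>J. leq j c"
  using J
proof (induction J)
  case empty
  then show ?case using directed_setD(1)[OF L] by auto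
next
  case (insert j J)
  then obtain c where c: "c \<in> \<Lambda>" "\<forall>j\<in>J. leq j c" by auto
  have j: "j \<in> \<Lambda>" and J: "J \<subseteq> \<Lambda>" using insert.prems by auto
  obtain d where d: "d \<in> \<Lambda>" "leq c d" "leq j d"
    using directed_setD(4)[OF L c(1) j] by auto
  have "leq i d" if i: "i \<in> J" for i
    using directed_setD(3)[OF L _ c(1) d(1) _ d(2), of i] i J c(2) by auto
  with d show ?case by (intro bexI[of _ d]) auto
qed

text \<open>Intersecting an open set with \<open>S\<close> does not alter its preimage. Hence the
  base and directedness facts, proved with target \<open>Y l\<close>, remain valid when the target
  is cut down to the image of the projection.\<close>

lemma pulled_back_open_subtopology:
  assumes "\<And>x. x \<in> topspace X \<Longrightarrow> \<pi> x \<in> S"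
  shows "pulled_back_open X (subtopology Z S) \<pi> = pulled_back_open X Z \<pi>"
proof
  fix W
  have eq: "{x \<in> topspace X. \<pi> x \<in> B \<inter> S} = {x \<in> topspace X. \<pi> x \<in> B}" for B
    using assms by auto
  have "pulled_back_open X (subtopology Z S) \<pi> W \<longleftrightarrow>
      (\<exists>B. openin Z B \<and> W = {x \<in> topspace X. \<pi> x \<in> B \<inter> S})"
    unfolding pulled_back_open_def openin_subtopology by auto
  then show "pulled_back_open X (subtopology Z S) \<pi> W = pulled_back_open X Z \<pi> W"
    unfolding eq pulled_back_open_def .
qed

context
  fixes G :: "('g, 'm) monoid_scheme"
    and \<Lambda> :: "'i set" and leq :: "'i \<Rightarrow> 'i \<Rightarrow> bool"
    and Y :: "'i \<Rightarrow> 'b topology" and \<Psi> :: "'i \<Rightarrow> 'g \<Rightarrow> 'b \<Rightarrow> 'b" and \<phi> :: "'i \<Rightarrow> 'i \<Rightarrow> 'b \<Rightarrow> 'b"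
  assumes inverse_system: "inverse_system G \<Lambda> leq Y \<Psi> \<phi>"
begin

section \<open>The limit as a compact space of threads\<close>

lemma system_directed: "directed_set \<Lambda> leq"
  and system_dynamical: "l \<in> \<Lambda> \<Longrightarrow> dynamical_system G (Y l) (\<Psi> l)"
  and bonding_continuous: "l \<in> \<Lambda> \<Longrightarrow> m \<in> \<Lambda> \<Longrightarrow> leq l m \<Longrightarrow> continuous_map (Y m) (Y l) (\<phi> m l)"
  and bonding_comp: "\<lbrakk>l \<in> \<Lambda>; m \<in> \<Lambda>; n \<in> \<Lambda>; leq l m; leq m n; x \<in> topspace (Y n)\<rbrakk> \<Longrightarrow>
        \<phi> n l x = \<phi> m l (\<phi> n m x)"
  and bonding_equivariant: "\<lbrakk>l \<in> \<Lambda>; m \<in> \<Lambda>; leq l m; g \<in> carrier G; x \<in> topspace (Y m)\<rbrakk> \<Longrightarrow>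
        \<Psi> l g (\<phi> m l x) = \<phi> m l (\<Psi> m g x)"
  using inverse_system unfolding inverse_system_def by simp_all

lemma leq_refl: "l \<in> \<Lambda> \<Longrightarrow> leq l l"
  and leq_trans: "\<lbrakk>l \<in> \<Lambda>; m \<in> \<Lambda>; n \<in> \<Lambda>; leq l m; leq m n\<rbrakk> \<Longrightarrow> leq l n"
  by (rule directed_setD[OF system_directed]; assumption)+

lemma upper_bound:
  assumes "l \<in> \<Lambda>" "m \<in> \<Lambda>"
  obtains n where "n \<in> \<Lambda>" "leq l n" "leq m n"
  using directed_setD(4)[OF system_directed assms] by auto

lemma bonding_in: "l \<in> \<Lambda> \<Longrightarrow> m \<in> \<Lambda> \<Longrightarrow> leq l m \<Longrightarrow> x \<in> topspace (Y m) \<Longrightarrow> \<phi> m l x \<in> topspace (Y l)"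
  using bonding_continuous[of l m] by (auto simp: continuous_map_def)

lemma system_Hausdorff: "l \<in> \<Lambda> \<Longrightarrow> Hausdorff_space (Y l)"
  and system_compact: "l \<in> \<Lambda> \<Longrightarrow> compact_space (Y l)"
  and system_action_in: "l \<in> \<Lambda> \<Longrightarrow> g \<in> carrier G \<Longrightarrow> x \<in> topspace (Y l) \<Longrightarrow> \<Psi> l g x \<in> topspace (Y l)"
proof -
  assume "l \<in> \<Lambda>"
  note d = system_dynamical[OF this, unfolded dynamical_system_def]
  show "Hausdorff_space (Y l)" "compact_space (Y l)" using d by simp_all
  assume "g \<in> carrier G" "x \<in> topspace (Y l)"
  then show "\<Psi> l g x \<in> topspace (Y l)"
    by (rule dynamical_system_action_in[OF system_dynamical[OF \<open>l \<in> \<Lambda>\<close>]])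
qed

text \<open>Imposing compatibility only on \<open>R\<close> makes it possible to exhibit points
  explicitly; the limit, where every equation holds, is then reached by compactness.\<close>

definition partial_threads :: "('i \<times> 'i) set \<Rightarrow> ('i \<Rightarrow> 'b) set" where
  "partial_threads R = {x \<in> topspace (product_topology Y \<Lambda>). \<forall>(l, m)\<in>R. x l = \<phi> m l (x m)}"

lemma partial_threadsI:
  assumes "x \<in> topspace (product_topology Y \<Lambda>)" "\<And>l m. (l, m) \<in> R \<Longrightarrow> x l = \<phi> m l (x m)"
  shows "x \<in> partial_threads R"
  using assms unfolding partial_threads_def by blast

lemma partial_threadsD:
  assumes "x \<in> partial_threads R"
  shows "x \<in> topspace (product_topology Y \<Lambda>)" "(l, m) \<in> R \<Longrightarrow> x l = \<phi> m l (x m)"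
  using assms unfolding partial_threads_def by blast+

lemma partial_threads_antimono: "R \<subseteq> R' \<Longrightarrow> partial_threads R' \<subseteq> partial_threads R"
  unfolding partial_threads_def by blast

text \<open>Each equation describes the equalizer of two continuous maps into a Hausdorff
  space.\<close>

lemma closedin_partial_threads:
  assumes R: "\<And>l m. (l, m) \<in> R \<Longrightarrow> l \<in> \<Lambda> \<and> m \<in> \<Lambda> \<and> leq l m"
  shows "closedin (product_topology Y \<Lambda>) (partial_threads R)"
proof -
  let ?X = "product_topology Y \<Lambda>"
  let ?C = "\<lambda>(l, m). {x \<in> topspace ?X. x l = \<phi> m l (x m)}"
  \<comment> \<open>Inserting \<open>topspace ?X\<close> keeps the intersection inside the product
    when \<open>R\<close> is empty.\<close>
  have eq: "partial_threads R = \<Inter>(insert (topspace ?X) (?C ` R))"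
    unfolding partial_threads_def by auto
  have "closedin ?X (?C p)" if p: "p \<in> R" for p
  proof -
    obtain l m where lm: "p = (l, m)" "l \<in> \<Lambda>" "m \<in> \<Lambda>" "leq l m" using R p by (cases p) auto
    have "continuous_map ?X (Y l) (\<lambda>x. \<phi> m l (x m))"
      using continuous_map_compose[where f = "\<lambda>x. x m" and X = ?X,
          OF _ bonding_continuous[OF lm(2-4)]]
        continuous_map_product_projection[of m \<Lambda> Y] lm(3) by (simp add: o_def)
    then show ?thesis
      using closedin_continuous_maps_eq[OF system_Hausdorff[OF lm(2)], of ?X "\<lambda>x. x l"]
        continuous_map_product_projection[of l \<Lambda> Y] lm(1,2) by simp
  qed
  then show ?thesis unfolding eq by (intro closedin_Inter) (auto simp del: topspace_product_topology)
qed

lemma topspace_inverse_limit: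
  "topspace (inverse_limit \<Lambda> leq Y \<phi>) = partial_threads {(l, m). l \<in> \<Lambda> \<and> m \<in> \<Lambda> \<and> leq l m}"
  unfolding inverse_limit_def partial_threads_def by auto

lemma inverse_limit_alt:
  "inverse_limit \<Lambda> leq Y \<phi> = subtopology (product_topology Y \<Lambda>)
     (partial_threads {(l, m). l \<in> \<Lambda> \<and> m \<in> \<Lambda> \<and> leq l m})"
proof -
  have "topspace (product_topology Y \<Lambda>) \<inter>
      {x. \<forall>l\<in>\<Lambda>. \<forall>\<eta>\<in>\<Lambda>. leq l \<eta> \<longrightarrow> x l = \<phi> \<eta> l (x \<eta>)} =
      partial_threads {(l, m). l \<in> \<Lambda> \<and> m \<in> \<Lambda> \<and> leq l m}"
    unfolding partial_threads_def by auto
  then show ?thesis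
    unfolding inverse_limit_def by (subst subtopology_restrict[symmetric]) (rule arg_cong)
qed

lemma compact_product: "compact_space (product_topology Y \<Lambda>)"
  using system_compact by (simp add: compact_space_product_topology)

lemma compact_inverse_limit: "compact_space (inverse_limit \<Lambda> leq Y \<phi>)"
proof -
  let ?T = "partial_threads {(l, m). l \<in> \<Lambda> \<and> m \<in> \<Lambda> \<and> leq l m}"
  have "closedin (product_topology Y \<Lambda>) ?T" by (rule closedin_partial_threads) auto
  then show ?thesis
    using compact_product unfolding inverse_limit_alt
    by (intro compact_space_subtopology closedin_compact_space)
qed

lemma inverse_limitD:
  assumes x: "x \<in> topspace (inverse_limit \<Lambda> leq Y \<phi>)"
  shows "l \<in> \<Lambda> \<Longrightarrow> x l \<in> topspace (Y l)" "x \<in> extensional \<Lambda>"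
    "l \<in> \<Lambda> \<Longrightarrow> m \<in> \<Lambda> \<Longrightarrow> leq l m \<Longrightarrow> x l = \<phi> m l (x m)"
proof -
  note t = partial_threadsD[OF x[unfolded topspace_inverse_limit]]
  show "l \<in> \<Lambda> \<Longrightarrow> x l \<in> topspace (Y l)" "x \<in> extensional \<Lambda>"
    using t(1) by (simp_all add: PiE_iff)
  show "l \<in> \<Lambda> \<Longrightarrow> m \<in> \<Lambda> \<Longrightarrow> leq l m \<Longrightarrow> x l = \<phi> m l (x m)"
    by (rule t(2)) simp
qed

lemma inverse_limitI:
  assumes "\<And>l. l \<in> \<Lambda> \<Longrightarrow> x l \<in> topspace (Y l)" "x \<in> extensional \<Lambda>"
    "\<And>l m. l \<in> \<Lambda> \<Longrightarrow> m \<in> \<Lambda> \<Longrightarrow> leq l m \<Longrightarrow> x l = \<phi> m l (x m)"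
  shows "x \<in> topspace (inverse_limit \<Lambda> leq Y \<phi>)"
  unfolding topspace_inverse_limit
proof (rule partial_threadsI)
  show "x \<in> topspace (product_topology Y \<Lambda>)" using assms(1,2) by (simp add: PiE_iff)
qed (use assms(3) in blast)

lemma limit_action_in:
  assumes g: "g \<in> carrier G" and x: "x \<in> topspace (inverse_limit \<Lambda> leq Y \<phi>)"
  shows "limit_action \<Lambda> \<Psi> g x \<in> topspace (inverse_limit \<Lambda> leq Y \<phi>)"
proof (rule inverse_limitI)
  show "limit_action \<Lambda> \<Psi> g x l \<in> topspace (Y l)" if "l \<in> \<Lambda>" for l
    using that inverse_limitD(1)[OF x] g by (simp add: limit_action_def system_action_in)
  show "limit_action \<Lambda> \<Psi> g x l = \<phi> m l (limit_action \<Lambda> \<Psi> g x m)"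
    if "l \<in> \<Lambda>" "m \<in> \<Lambda>" "leq l m" for l m
    using inverse_limitD(1)[OF x that(2)] inverse_limitD(3)[OF x that] that g
    by (simp add: limit_action_def bonding_equivariant)
qed (simp add: limit_action_def)

lemma continuous_projection:
  "l \<in> \<Lambda> \<Longrightarrow> continuous_map (inverse_limit \<Lambda> leq Y \<phi>) (Y l) (\<lambda>x. x l)"
  unfolding inverse_limit_def
  by (rule continuous_map_from_subtopology[OF continuous_map_product_projection])

text \<open>For \<open>z\<close> in the stable image, \<open>stable\<close> provides a preimage of
  \<open>z\<close> in every \<open>Y n\<close> with \<open>n\<close> above \<open>m\<close>. From it
  one builds a point of the product that has coordinate \<open>z\<close> at \<open>l\<close> and is
  compatible below \<open>n\<close>; compactness turns these approximations into a thread through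
  \<open>z\<close>.\<close>

lemma projection_inverse_limit:
  assumes l: "l \<in> \<Lambda>" and m: "m \<in> \<Lambda>" "leq l m"
    and stable: "\<And>n. n \<in> \<Lambda> \<Longrightarrow> leq m n \<Longrightarrow> \<phi> n l ` topspace (Y n) = \<phi> m l ` topspace (Y m)"
  shows "(\<lambda>x. x l) ` topspace (inverse_limit \<Lambda> leq Y \<phi>) = \<phi> m l ` topspace (Y m)"
proof
  show "(\<lambda>x. x l) ` topspace (inverse_limit \<Lambda> leq Y \<phi>) \<subseteq> \<phi> m l ` topspace (Y m)"
  proof (rule image_subsetI)
    fix x assume x: "x \<in> topspace (inverse_limit \<Lambda> leq Y \<phi>)"
    show "x l \<in> \<phi> m l ` topspace (Y m)"
      using inverse_limitD(3)[OF x l m] inverse_limitD(1)[OF x m(1)] by (rule image_eqI)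
  qed
  show "\<phi> m l ` topspace (Y m) \<subseteq> (\<lambda>x. x l) ` topspace (inverse_limit \<Lambda> leq Y \<phi>)"
  proof
    fix z assume z: "z \<in> \<phi> m l ` topspace (Y m)"
    let ?X = "product_topology Y \<Lambda>"
    let ?R = "\<lambda>n. {(a, b). a \<in> \<Lambda> \<and> b \<in> \<Lambda> \<and> leq a b \<and> leq b n}"
    define I where "I = {n \<in> \<Lambda>. leq m n}"
    \<comment> \<open>Only equations between indices below \<open>n\<close> are imposed, so by
      transitivity the closed sets \<open>D n\<close> shrink as \<open>n\<close> grows.\<close>
    define D where "D n = partial_threads (?R n) \<inter> {x \<in> topspace ?X. x l \<in> {z}}" for n
    have zY: "z \<in> topspace (Y l)" using z bonding_in[OF l m] by auto
    have "(\<Inter>n\<in>I. D n) \<noteq> {}"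
    proof (rule compact_space_directed_Inter[OF compact_product])
      show "I \<noteq> {}" using m leq_refl unfolding I_def by auto
    next
      fix n
      have "closedin (Y l) {z}"
        using closedin_Hausdorff_singleton[OF system_Hausdorff[OF l] zY] .
      then have "closedin ?X {x \<in> topspace ?X. x l \<in> {z}}"
        by (rule closedin_continuous_map_preimage[OF continuous_map_product_projection[OF l]])
      moreover have "closedin ?X (partial_threads (?R n))"
        by (rule closedin_partial_threads) auto
      ultimately show "closedin ?X (D n)" unfolding D_def by (intro closedin_Int)
    next
      fix n assume "n \<in> I"
      then have n: "n \<in> \<Lambda>" "leq m n" unfolding I_def by auto
      have "z \<in> \<phi> n l ` topspace (Y n)" using z stable[OF n] by simp
      then obtain y where y: "y \<in> topspace (Y n)" "z = \<phi> n l y" by auto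
      have ln: "leq l n" using leq_trans[OF l m(1) n(1) m(2) n(2)] .
      \<comment> \<open>Coordinates not below \<open>n\<close> may be filled arbitrarily, provided
        that no space is empty: for \<open>c\<close> above \<open>a\<close> and \<open>m\<close>,
        some point of \<open>Y c\<close> lies over \<open>z\<close>, and it maps into
        \<open>Y a\<close>.\<close>
      have inh: "\<exists>w. w \<in> topspace (Y a)" if a: "a \<in> \<Lambda>" for a
      proof -
        obtain c where c: "c \<in> \<Lambda>" "leq a c" "leq m c" using upper_bound[OF a m(1)] .
        then have "z \<in> \<phi> c l ` topspace (Y c)" using z stable[OF c(1,3)] by simp
        then obtain w where "w \<in> topspace (Y c)" by (rule imageE)
        from bonding_in[OF a c(1,2) this] show ?thesis by (rule exI)
      qed
      \<comment> \<open>Below \<open>n\<close> the coordinates are images of the single point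
        \<open>y\<close>, hence compatible. A pair in \<open>?R n\<close> has both indices below
        \<open>n\<close>, so the arbitrary values elsewhere never enter an equation.\<close>
      define x where "x = (\<lambda>a\<in>\<Lambda>. if leq a n then \<phi> n a y else SOME w. w \<in> topspace (Y a))"
      have "x a \<in> topspace (Y a)" if a: "a \<in> \<Lambda>" for a
        using someI_ex[OF inh[OF a]] bonding_in[OF a n(1) _ y(1)] a by (simp add: x_def)
      then have "x \<in> topspace ?X" by (simp add: PiE_iff x_def)
      have "x a = \<phi> b a (x b)" if "(a, b) \<in> ?R n" for a b
      proof -
        have ab: "a \<in> \<Lambda>" "b \<in> \<Lambda>" "leq a b" "leq b n" using that by auto
        show ?thesis using ab leq_trans[OF ab(1,2) n(1) ab(3,4)] bonding_comp[OF ab(1,2) n(1) ab(3,4) y(1)]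
          by (simp add: x_def)
      qed
      then have "x \<in> partial_threads (?R n)" by (rule partial_threadsI[OF \<open>x \<in> topspace ?X\<close>])
      moreover have "x l = z" using l ln y by (simp add: x_def)
      ultimately have "x \<in> D n" using \<open>x \<in> topspace ?X\<close> unfolding D_def by simp
      then show "D n \<noteq> {}" by auto
    next
      fix a b assume ab: "a \<in> I" "b \<in> I"
      then have ab': "a \<in> \<Lambda>" "b \<in> \<Lambda>" "leq m a" unfolding I_def by simp_all
      obtain c where c: "c \<in> \<Lambda>" "leq a c" "leq b c" using upper_bound[OF ab'(1,2)] .
      have "c \<in> I" using c(1) leq_trans[OF m(1) ab'(1) c(1) ab'(3) c(2)] unfolding I_def by simp
      moreover have "?R a \<subseteq> ?R c" "?R b \<subseteq> ?R c"
        using leq_trans[OF _ ab'(1) c(1) _ c(2)] leq_trans[OF _ ab'(2) c(1) _ c(3)] by auto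
      then have "D c \<subseteq> D a \<inter> D b"
        using partial_threads_antimono[of "?R a" "?R c"] partial_threads_antimono[of "?R b" "?R c"]
        unfolding D_def by auto
      ultimately show "\<exists>c\<in>I. D c \<subseteq> D a \<inter> D b" by auto
    qed
    then obtain x where x: "\<And>n. n \<in> I \<Longrightarrow> x \<in> D n" by auto
    have m_I: "m \<in> I" using m leq_refl unfolding I_def by auto
    have "x \<in> topspace (inverse_limit \<Lambda> leq Y \<phi>)"
    proof (rule inverse_limitI)
      show "x a \<in> topspace (Y a)" if "a \<in> \<Lambda>" for a using x[OF m_I] that unfolding D_def by auto
      show "x \<in> extensional \<Lambda>" using x[OF m_I] unfolding D_def by (auto simp: PiE_iff)
      show "x a = \<phi> b a (x b)" if ab: "a \<in> \<Lambda>" "b \<in> \<Lambda>" "leq a b" for a b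
      proof -
        \<comment> \<open>Each single equation is imposed by \<open>D n\<close> as soon as
          \<open>n\<close> lies above \<open>b\<close> and above \<open>m\<close>.\<close>
        obtain n where "n \<in> \<Lambda>" "leq b n" "leq m n" using upper_bound[OF ab(2) m(1)] .
        then have "x \<in> partial_threads (?R n)" "(a, b) \<in> ?R n"
          using x[of n] ab unfolding I_def D_def by auto
        then show ?thesis by (rule partial_threadsD(2))
      qed
    qed
    moreover have "x l = z" using x[OF m_I] unfolding D_def by auto
    ultimately show "z \<in> (\<lambda>x. x l) ` topspace (inverse_limit \<Lambda> leq Y \<phi>)" by auto
  qed
qed

section \<open>Approximating the limit by its projections\<close>

lemma pulled_back_open_leq:
  assumes l: "l \<in> \<Lambda>" and m: "m \<in> \<Lambda>" "leq l m"
    and W: "pulled_back_open (inverse_limit \<Lambda> leq Y \<phi>) (Y l) (\<lambda>x. x l) W"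
  shows "pulled_back_open (inverse_limit \<Lambda> leq Y \<phi>) (Y m) (\<lambda>x. x m) W"
proof -
  let ?X = "inverse_limit \<Lambda> leq Y \<phi>"
  obtain B where B: "openin (Y l) B" "W = {x \<in> topspace ?X. x l \<in> B}"
    using W unfolding pulled_back_open_def by auto
  have "openin (Y m) {y \<in> topspace (Y m). \<phi> m l y \<in> B}"
    by (rule openin_continuous_map_preimage[OF bonding_continuous[OF l m] B(1)])
  moreover have "W = {x \<in> topspace ?X. x m \<in> {y \<in> topspace (Y m). \<phi> m l y \<in> B}}"
    unfolding B(2) using inverse_limitD(1)[OF _ m(1)] inverse_limitD(3)[OF _ l m] by auto
  ultimately show ?thesis unfolding pulled_back_open_def by (intro exI conjI)
qed

text \<open>A product neighbourhood restricts finitely many coordinates; for an index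
  \<open>m\<close> above all of them these coordinates are functions of \<open>x m\<close>, so a
  condition on one coordinate suffices.\<close>

lemma inverse_limit_base:
  assumes U: "openin (inverse_limit \<Lambda> leq Y \<phi>) U" and x: "x \<in> U"
  shows "\<exists>l\<in>\<Lambda>. \<exists>W. pulled_back_open (inverse_limit \<Lambda> leq Y \<phi>) (Y l) (\<lambda>x. x l) W \<and> x \<in> W \<and> W \<subseteq> U"
proof -
  let ?X = "inverse_limit \<Lambda> leq Y \<phi>"
  obtain T where T: "openin (product_topology Y \<Lambda>) T" "U = T \<inter> topspace ?X"
    using U unfolding topspace_inverse_limit unfolding inverse_limit_alt openin_subtopology
    by (elim exE conjE)
  have xT: "x \<in> T" and xX: "x \<in> topspace ?X" using x unfolding T(2) by simp_all
  obtain V where V: "finite {l \<in> \<Lambda>. V l \<noteq> topspace (Y l)}"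
    "\<forall>l\<in>\<Lambda>. openin (Y l) (V l)" "x \<in> Pi\<^sub>E \<Lambda> V" "Pi\<^sub>E \<Lambda> V \<subseteq> T"
    using T(1)[unfolded openin_product_topology_alt, rule_format, OF xT] by (elim exE conjE)
  let ?J = "{l \<in> \<Lambda>. V l \<noteq> topspace (Y l)}"
  obtain m where m: "m \<in> \<Lambda>" "\<forall>l\<in>?J. leq l m"
    using directed_set_finite_upper_bound[OF system_directed V(1)] by auto
  have lm: "leq l m" "l \<in> \<Lambda>" if "l \<in> ?J" for l using m(2) that by simp_all
  \<comment> \<open>Intersecting with \<open>topspace (Y m)\<close> keeps \<open>B\<close> open when
    \<open>?J\<close> is empty.\<close>
  define B where "B = topspace (Y m) \<inter> (\<Inter>l\<in>?J. {y \<in> topspace (Y m). \<phi> m l y \<in> V l})"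
  define W where "W = {x \<in> topspace ?X. x m \<in> B}"
  have BI: "y \<in> B \<longleftrightarrow> y \<in> topspace (Y m) \<and> (\<forall>l\<in>?J. \<phi> m l y \<in> V l)" for y
    unfolding B_def by auto
  have "openin (Y m) {y \<in> topspace (Y m). \<phi> m l y \<in> V l}" if l: "l \<in> ?J" for l
    by (rule openin_continuous_map_preimage[OF bonding_continuous[OF lm(2)[OF l] m(1) lm(1)[OF l]]])
      (use V(2) lm(2)[OF l] in simp)
  then have "openin (Y m) B" unfolding B_def using V(1) by (intro openin_Int_Inter) auto
  then have "pulled_back_open ?X (Y m) (\<lambda>x. x m) W"
    unfolding pulled_back_open_def W_def by auto
  moreover have "x \<in> W"
  proof -
    have "\<phi> m l (x m) \<in> V l" if l: "l \<in> ?J" for l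
      using inverse_limitD(3)[OF xX lm(2)[OF l] m(1) lm(1)[OF l]] PiE_mem[OF V(3) lm(2)[OF l]]
      by (rule subst)
    then show ?thesis
      using inverse_limitD(1)[OF xX m(1)] xX unfolding W_def BI by (intro CollectI conjI ballI)
  qed
  moreover have "W \<subseteq> U"
  proof
    fix w assume w: "w \<in> W"
    then have w': "w \<in> topspace ?X" and wB: "\<forall>l\<in>?J. \<phi> m l (w m) \<in> V l"
      unfolding W_def BI by simp_all
    have "w l \<in> V l" if l: "l \<in> \<Lambda>" for l
    proof (cases "l \<in> ?J")
      case True
      show ?thesis
        using inverse_limitD(3)[OF w' l m(1) lm(1)[OF True], symmetric] bspec[OF wB True]
        by (rule subst)
    next
      case False
      then show ?thesis using l inverse_limitD(1)[OF w' l] by simp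
    qed
    then have "w \<in> Pi\<^sub>E \<Lambda> V" using inverse_limitD(2)[OF w'] by (simp add: PiE_iff)
    then show "w \<in> U" using V(4) w' unfolding T(2) by auto
  qed
  ultimately show ?thesis using m(1) by (intro bexI[of _ m] exI[of _ W] conjI)
qed

lemma has_property_inverse_limit:
  assumes G: "group G" and mittag: "mittag_leffler \<Lambda> leq Y \<phi>"
    and P: "\<And>l. l \<in> \<Lambda> \<Longrightarrow> has_property P G (Y l) (\<Psi> l)"
  shows "has_property P G (inverse_limit \<Lambda> leq Y \<phi>) (limit_action \<Lambda> \<Psi>)"
proof -
  let ?X = "inverse_limit \<Lambda> leq Y \<phi>"
  let ?stable = "\<lambda>l m. m \<in> \<Lambda> \<and> leq l m \<and>
    (\<forall>n\<in>\<Lambda>. leq m n \<longrightarrow> \<phi> n l ` topspace (Y n) = \<phi> m l ` topspace (Y m))"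
  define s where "s l = (SOME m. ?stable l m)" for l
  \<comment> \<open>This subspace plays two roles: it is the image of the projection, hence a factor
    of the limit, and it is a factor of \<open>Y (s l)\<close>, which gives it the property.
    \<open>Y l\<close> would not do, since the projection to it may fail to be onto.\<close>
  define Z where "Z l = subtopology (Y l) (\<phi> (s l) l ` topspace (Y (s l)))" for l
  have s: "s l \<in> \<Lambda>" "leq l (s l)"
    "\<And>n. n \<in> \<Lambda> \<Longrightarrow> leq (s l) n \<Longrightarrow> \<phi> n l ` topspace (Y n) = \<phi> (s l) l ` topspace (Y (s l))"
    if "l \<in> \<Lambda>" for l
  proof -
    have "\<exists>m. ?stable l m" using mittag that unfolding mittag_leffler_def by auto
    then have "?stable l (s l)" unfolding s_def by (rule someI_ex)
    then show "s l \<in> \<Lambda>" "leq l (s l)"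
      "\<And>n. n \<in> \<Lambda> \<Longrightarrow> leq (s l) n \<Longrightarrow> \<phi> n l ` topspace (Y n) = \<phi> (s l) l ` topspace (Y (s l))"
      by auto
  qed
  have img: "(\<lambda>x. x l) ` topspace ?X = \<phi> (s l) l ` topspace (Y (s l))" if l: "l \<in> \<Lambda>" for l
    by (rule projection_inverse_limit[OF l s[OF l]])
  have Zt: "topspace (Z l) = \<phi> (s l) l ` topspace (Y (s l))" if l: "l \<in> \<Lambda>" for l
    unfolding Z_def using bonding_in[OF l s(1,2)[OF l]] by auto
  have pb: "pulled_back_open ?X (Z l) (\<lambda>x. x l) = pulled_back_open ?X (Y l) (\<lambda>x. x l)"
    if l: "l \<in> \<Lambda>" for l
    unfolding Z_def by (rule pulled_back_open_subtopology) (simp flip: img[OF l])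
  have "approximating_factors G ?X (limit_action \<Lambda> \<Psi>) \<Lambda> Z \<Psi> (\<lambda>l x. x l)"
  proof (rule approximating_factors.intro)
    show "factor_map G ?X (limit_action \<Lambda> \<Psi>) (Z l) (\<Psi> l) (\<lambda>x. x l)" if l: "l \<in> \<Lambda>" for l
      unfolding factor_map_def
    proof (intro conjI ballI)
      show "continuous_map ?X (Z l) (\<lambda>x. x l)"
        unfolding Z_def using continuous_projection[OF l] img[OF l]
        by (auto simp: continuous_map_in_subtopology)
      show "(\<lambda>x. x l) ` topspace ?X = topspace (Z l)" using img[OF l] Zt[OF l] by simp
      show "limit_action \<Lambda> \<Psi> g x \<in> topspace ?X" if "g \<in> carrier G" "x \<in> topspace ?X" for g x
        using limit_action_in[OF that] .
      show "limit_action \<Lambda> \<Psi> g x l = \<Psi> l g (x l)" for g x using l by (simp add: limit_action_def)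
    qed
    show "\<Lambda> \<noteq> {}" by (rule directed_setD(1)[OF system_directed])
    show "\<exists>c\<in>\<Lambda>. \<forall>W. pulled_back_open ?X (Z a) (\<lambda>x. x a) W \<or> pulled_back_open ?X (Z b) (\<lambda>x. x b) W
        \<longrightarrow> pulled_back_open ?X (Z c) (\<lambda>x. x c) W" if a: "a \<in> \<Lambda>" and b: "b \<in> \<Lambda>" for a b
    proof -
      obtain c where c: "c \<in> \<Lambda>" "leq a c" "leq b c" using upper_bound[OF a b] .
      then show ?thesis
        using pulled_back_open_leq[OF a c(1,2)] pulled_back_open_leq[OF b c(1,3)]
        by (intro bexI[OF _ c(1)]) (auto simp: pb a b)
    qed
    show "\<exists>l\<in>\<Lambda>. \<exists>W. pulled_back_open ?X (Z l) (\<lambda>x. x l) W \<and> x \<in> W \<and> W \<subseteq> U"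
      if "openin ?X U" "x \<in> U" for U x
      using inverse_limit_base[OF that] pb by (simp cong: bex_cong)
  qed (rule G)
  then show ?thesis
  proof (rule approximating_factors.has_property_lift)
    show "compact_space ?X" by (rule compact_inverse_limit)
    show "Hausdorff_space (Z l)" if "l \<in> \<Lambda>" for l
      unfolding Z_def by (rule Hausdorff_space_subtopology[OF system_Hausdorff[OF that]])
    show "has_property P G (Z l) (\<Psi> l)" if l: "l \<in> \<Lambda>" for l
    proof (rule has_property_factor[OF G _ P])
      show "s l \<in> \<Lambda>" by (rule s(1)[OF l])
      show "factor_map G (Y (s l)) (\<Psi> (s l)) (Z l) (\<Psi> l) (\<phi> (s l) l)"
        unfolding factor_map_def
      proof (intro conjI ballI)
        show "continuous_map (Y (s l)) (Z l) (\<phi> (s l) l)"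
          unfolding Z_def using bonding_continuous[OF l s(1,2)[OF l]]
          by (auto simp: continuous_map_in_subtopology)
        show "\<phi> (s l) l ` topspace (Y (s l)) = topspace (Z l)" using Zt[OF l] by simp
        show "\<Psi> (s l) g x \<in> topspace (Y (s l))" "\<phi> (s l) l (\<Psi> (s l) g x) = \<Psi> l g (\<phi> (s l) l x)"
          if "g \<in> carrier G" "x \<in> topspace (Y (s l))" for g x
          using system_action_in[OF s(1)[OF l] that] bonding_equivariant[OF l s(1,2)[OF l] that]
          by simp_all
      qed
    qed
  qed
qed

end

section \<open>Conjugacy and the return from the limit to the system\<close>

lemma conjugate_imp_factor_map:
  assumes X: "dynamical_system G X \<Phi>" and c: "conjugate G X \<Phi> Y \<Psi>"
  obtains k where "factor_map G Y \<Psi> X \<Phi> k"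
proof -
  obtain h where h: "homeomorphic_map X Y h"
    "\<And>g x. g \<in> carrier G \<Longrightarrow> x \<in> topspace X \<Longrightarrow> h (\<Phi> g x) = \<Psi> g (h x)"
    using c unfolding conjugate_def by auto
  obtain k where "homeomorphic_maps X Y h k" using h(1) unfolding homeomorphic_map_maps by auto
  then have k: "continuous_map X Y h" "continuous_map Y X k"
    "\<And>x. x \<in> topspace X \<Longrightarrow> k (h x) = x" "\<And>y. y \<in> topspace Y \<Longrightarrow> h (k y) = y"
    unfolding homeomorphic_maps_def by auto
  have hY: "h x \<in> topspace Y" if "x \<in> topspace X" for x using k(1) that by (auto simp: continuous_map_def)
  have kX: "k y \<in> topspace X" if "y \<in> topspace Y" for y using k(2) that by (auto simp: continuous_map_def)
  have "factor_map G Y \<Psi> X \<Phi> k"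
    unfolding factor_map_def
  proof (intro conjI ballI)
    show "k ` topspace Y = topspace X"
    proof
      show "topspace X \<subseteq> k ` topspace Y" using k(3) hY by (metis image_eqI subsetI)
    qed (use kX in auto)
    fix g y assume gy: "g \<in> carrier G" "y \<in> topspace Y"
    \<comment> \<open>Both claims follow from this form, including the invariance of
      \<open>topspace Y\<close>, as \<open>Y\<close> is not assumed to be a dynamical
      system.\<close>
    have eq: "\<Psi> g y = h (\<Phi> g (k y))" using h(2)[OF gy(1) kX[OF gy(2)]] k(4)[OF gy(2)] by simp
    show "\<Psi> g y \<in> topspace Y" "k (\<Psi> g y) = \<Phi> g (k y)"
      unfolding eq using dynamical_system_action_in[OF X gy(1) kX[OF gy(2)]] hY k(3) by simp_all
  qed (rule k(2))
  then show thesis by (rule that)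
qed

text \<open>Invariance under conjugacy takes no separate argument: the inverse of the conjugacy is a
  factor map from the limit onto \<open>X\<close>.\<close>

lemma has_property_if_conjugate_limit:
  assumes G: "group G" and X: "dynamical_system G X \<Phi>"
    and mittag: "mittag_leffler_system_of_subshifts P G \<Lambda> leq A S \<phi>"
    and c: "conjugate_to_limit_of_subshifts G X \<Phi> \<Lambda> leq A S \<phi>"
  shows "has_property P G X \<Phi>"
proof -
  let ?Y = "\<lambda>l. subshift_space G (A l) (S l)"
  obtain k where k: "factor_map G (inverse_limit \<Lambda> leq ?Y \<phi>) (limit_action \<Lambda> (\<lambda>_. shift_action G)) X \<Phi> k"
    using conjugate_imp_factor_map[OF X] c unfolding conjugate_to_limit_of_subshifts_def by auto
  have "has_property P G (inverse_limit \<Lambda> leq ?Y \<phi>) (limit_action \<Lambda> (\<lambda>_. shift_action G))"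
    using mittag unfolding mittag_leffler_system_of_subshifts_def
    by (intro has_property_inverse_limit[OF _ G]) auto
  then show ?thesis by (rule has_property_factor[OF G k])
qed

section \<open>Spaces as inverse limits of their factors\<close>

text \<open>Allows the continuity of a map out of \<open>Y\<close> to be tested after composition
  with \<open>\<pi>\<close>.\<close>

lemma factor_map_quotient:
  assumes "compact_space X" and "factor_map G X \<Phi> Y \<Psi> \<pi>" and "Hausdorff_space Y"
  shows "quotient_map X Y \<pi>"
  using assms unfolding factor_map_def by (intro T1_Spaces.continuous_imp_quotient_map) simp_all

text \<open>The action laws transport along the surjection, and \<open>\<Psi> g\<close> is
  continuous by the quotient property of \<open>\<pi>\<close>. The action of the inverse of
  \<open>g\<close> is its continuous inverse, which makes it a homeomorphism.\<close>

lemma factor_dynamical_system: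
  assumes G: "group G" and X: "dynamical_system G X \<Phi>"
    and f: "factor_map G X \<Phi> Y \<Psi> \<pi>" and H: "Hausdorff_space Y"
  shows "dynamical_system G Y \<Psi>"
proof -
  interpret group G by (rule G)
  have cX: "compact_space X" using X by (simp add: dynamical_system_def)
  have \<pi>: "continuous_map X Y \<pi>" "\<pi> ` topspace X = topspace Y"
    and eq: "\<And>g x. g \<in> carrier G \<Longrightarrow> x \<in> topspace X \<Longrightarrow> \<Psi> g (\<pi> x) = \<pi> (\<Phi> g x)"
    using f unfolding factor_map_def by simp_all
  have \<Phi>in: "\<Phi> g x \<in> topspace X" if "g \<in> carrier G" "x \<in> topspace X" for g x
    using dynamical_system_action_in[OF X that] .
  have \<Phi>1: "\<Phi> \<one>\<^bsub>G\<^esub> x = x" if "x \<in> topspace X" for x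
    using X that by (simp add: dynamical_system_def)
  have \<Phi>m: "\<Phi> (g \<otimes>\<^bsub>G\<^esub> h) x = \<Phi> g (\<Phi> h x)" if "g \<in> carrier G" "h \<in> carrier G" "x \<in> topspace X" for g h x
    using X that by (simp add: dynamical_system_def)
  have lift: "\<exists>x\<in>topspace X. y = \<pi> x" if "y \<in> topspace Y" for y
    using that unfolding \<pi>(2)[symmetric] by auto
  have one: "\<Psi> \<one>\<^bsub>G\<^esub> y = y" if y: "y \<in> topspace Y" for y
  proof -
    obtain x where x: "x \<in> topspace X" "y = \<pi> x" using lift[OF y] by auto
    then show ?thesis using eq[OF one_closed x(1)] \<Phi>1[OF x(1)] by simp
  qed
  have mult: "\<Psi> (g \<otimes>\<^bsub>G\<^esub> h) y = \<Psi> g (\<Psi> h y)"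
    if gh: "g \<in> carrier G" "h \<in> carrier G" and y: "y \<in> topspace Y" for g h y
  proof -
    obtain x where x: "x \<in> topspace X" "y = \<pi> x" using lift[OF y] by auto
    then show ?thesis using gh by (simp add: eq \<Phi>m \<Phi>in)
  qed
  have cont: "continuous_map Y Y (\<Psi> g)" if g: "g \<in> carrier G" for g
  proof (rule continuous_compose_quotient_map[OF factor_map_quotient[OF cX f H]])
    have "continuous_map X X (\<Phi> g)"
      using X g by (simp add: dynamical_system_def homeomorphic_imp_continuous_map)
    then have "continuous_map X Y (\<pi> \<circ> \<Phi> g)" using \<pi>(1) by (rule continuous_map_compose)
    then show "continuous_map X Y (\<Psi> g \<circ> \<pi>)"
      by (rule continuous_map_eq) (simp add: eq[OF g])
  qed
  have "homeomorphic_map Y Y (\<Psi> g)" if g: "g \<in> carrier G" for g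
  proof -
    have "homeomorphic_maps Y Y (\<Psi> g) (\<Psi> (inv\<^bsub>G\<^esub> g))"
      unfolding homeomorphic_maps_def
      using cont[OF g] cont[OF inv_closed[OF g]] mult[OF g inv_closed[OF g]] mult[OF inv_closed[OF g] g]
        one g by simp
    then show ?thesis unfolding homeomorphic_map_maps by auto
  qed
  moreover have "compact_space Y"
    using image_compactin[OF cX[unfolded compact_space_def] \<pi>(1)] \<pi>(2) unfolding compact_space_def by simp
  ultimately show ?thesis unfolding dynamical_system_def using H one mult by simp
qed

context
  fixes G :: "('g, 'm) monoid_scheme"
    and X :: "'a topology" and \<Phi> :: "'g \<Rightarrow> 'a \<Rightarrow> 'a"
    and \<Lambda> :: "'i set" and leq :: "'i \<Rightarrow> 'i \<Rightarrow> bool"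
    and Y :: "'i \<Rightarrow> 'b topology" and \<Psi> :: "'i \<Rightarrow> 'g \<Rightarrow> 'b \<Rightarrow> 'b" and \<pi> :: "'i \<Rightarrow> 'a \<Rightarrow> 'b"
  assumes G: "group G" and X: "dynamical_system G X \<Phi>"
    and directed: "directed_set \<Lambda> leq"
    and factor: "l \<in> \<Lambda> \<Longrightarrow> factor_map G X \<Phi> (Y l) (\<Psi> l) (\<pi> l)"
    and Hausdorff: "l \<in> \<Lambda> \<Longrightarrow> Hausdorff_space (Y l)"
    and refines: "\<lbrakk>l \<in> \<Lambda>; m \<in> \<Lambda>; leq l m; x \<in> topspace X; x' \<in> topspace X; \<pi> m x = \<pi> m x'\<rbrakk> \<Longrightarrow>
          \<pi> l x = \<pi> l x'"
begin

text \<open>By \<open>refines\<close> the value does not depend on which preimage of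
  \<open>y\<close> under \<open>\<pi> m\<close> is chosen.\<close>

definition induced_bonding :: "'i \<Rightarrow> 'i \<Rightarrow> 'b \<Rightarrow> 'b" where
  "induced_bonding m l y = \<pi> l (inv_into (topspace X) (\<pi> m) y)"

lemma induced_bonding_eq:
  assumes "l \<in> \<Lambda>" "m \<in> \<Lambda>" "leq l m" and x: "x \<in> topspace X"
  shows "induced_bonding m l (\<pi> m x) = \<pi> l x"
proof -
  have "\<pi> m x \<in> \<pi> m ` topspace X" using x by simp
  then show ?thesis unfolding induced_bonding_def
    by (intro refines[OF assms(1-3)] x) (rule inv_into_into f_inv_into_f; assumption)+
qed

lemma factor_space_lift:
  assumes "l \<in> \<Lambda>" "y \<in> topspace (Y l)"
  obtains x where "x \<in> topspace X" "y = \<pi> l x"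
  using factor[OF assms(1)] assms(2) unfolding factor_map_def by (metis imageE)

lemma factor_equivariant:
  assumes "l \<in> \<Lambda>" "g \<in> carrier G" "x \<in> topspace X"
  shows "\<Psi> l g (\<pi> l x) = \<pi> l (\<Phi> g x)"
  using factor[OF assms(1)] assms(2,3) unfolding factor_map_def by simp

lemma factor_image: "l \<in> \<Lambda> \<Longrightarrow> \<pi> l ` topspace X = topspace (Y l)"
  using factor unfolding factor_map_def by simp

text \<open>Every point of \<open>Y m\<close> is some \<open>\<pi> m x\<close>, and
  \<open>induced_bonding_eq\<close> reduces the algebraic conditions to identities on
  \<open>X\<close>. Continuity is tested on \<open>X\<close>, since \<open>\<pi> m\<close> is a
  quotient map.\<close>

lemma induced_inverse_system: "inverse_system G \<Lambda> leq Y \<Psi> induced_bonding"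
  unfolding inverse_system_def
proof (intro conjI ballI impI, goal_cases)
  case 1
  show ?case by (rule directed)
next
  case (2 l)
  show ?case by (rule factor_dynamical_system[OF G X factor[OF 2] Hausdorff[OF 2]])
next
  case (3 l m)
  have cX: "compact_space X" using X by (simp add: dynamical_system_def)
  show ?case
  proof (rule continuous_compose_quotient_map[OF factor_map_quotient[OF cX factor[OF 3(2)] Hausdorff[OF 3(2)]]])
    have "continuous_map X (Y l) (\<pi> l)" using factor[OF 3(1)] unfolding factor_map_def by simp
    then show "continuous_map X (Y l) (induced_bonding m l \<circ> \<pi> m)"
      by (rule continuous_map_eq) (simp add: induced_bonding_eq[OF 3])
  qed
next
  case (4 l y)
  obtain x where x: "x \<in> topspace X" "y = \<pi> l x" using factor_space_lift[OF 4] .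
  show ?case unfolding x(2) by (rule induced_bonding_eq[OF 4(1,1) directed_setD(2)[OF directed 4(1)] x(1)])
next
  case (5 l m n y)
  then have lm: "leq l m" and mn: "leq m n" by simp_all
  obtain x where x: "x \<in> topspace X" "y = \<pi> n x" using factor_space_lift[OF 5(3,5)] .
  have "leq l n" by (rule directed_setD(3)[OF directed 5(1-3) lm mn])
  then show ?case unfolding x(2)
    using induced_bonding_eq[OF 5(1,3) _ x(1)] induced_bonding_eq[OF 5(2,3) mn x(1)]
      induced_bonding_eq[OF 5(1,2) lm x(1)] by simp
next
  case (6 l m g y)
  obtain x where x: "x \<in> topspace X" "y = \<pi> m x" using factor_space_lift[OF 6(2,5)] .
  show ?case unfolding x(2)
    using dynamical_system_action_in[OF X 6(4) x(1)]
    by (simp add: induced_bonding_eq[OF 6(1-3)] factor_equivariant[OF 6(1,4)]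
      factor_equivariant[OF 6(2,4)] x(1))
qed

text \<open>The bonding maps inherit surjectivity from the maps \<open>\<pi> l\<close>, so each
  index is already stable at itself.\<close>

lemma induced_mittag_leffler: "mittag_leffler \<Lambda> leq Y induced_bonding"
proof -
  have onto: "induced_bonding m l ` topspace (Y m) = topspace (Y l)"
    if lm: "l \<in> \<Lambda>" "m \<in> \<Lambda>" "leq l m" for l m
  proof -
    have "induced_bonding m l ` topspace (Y m) = (\<lambda>x. induced_bonding m l (\<pi> m x)) ` topspace X"
      unfolding factor_image[OF lm(2), symmetric] image_image ..
    also have "\<dots> = \<pi> l ` topspace X"
      using induced_bonding_eq[OF lm] by (intro image_cong) simp_all
    finally show ?thesis unfolding factor_image[OF lm(1)] .
  qed
  show ?thesis
    unfolding mittag_leffler_def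
  proof
    fix l assume l: "l \<in> \<Lambda>"
    have "leq l l" by (rule directed_setD(2)[OF directed l])
    with l show "\<exists>m\<in>\<Lambda>. leq l m \<and> (\<forall>n\<in>\<Lambda>. leq m n \<longrightarrow>
        induced_bonding n l ` topspace (Y n) = induced_bonding m l ` topspace (Y m))"
      by (intro bexI[of _ l] conjI ballI impI) (simp_all only: onto)
  qed
qed

text \<open>A continuous bijection from a compact space to a Hausdorff space is a homeomorphism.
  Injectivity is \<open>separating\<close>; surjectivity comes from compactness.\<close>

lemma conjugate_induced_inverse_limit:
  assumes separating: "\<And>x x'. \<lbrakk>x \<in> topspace X; x' \<in> topspace X; x \<noteq> x'\<rbrakk> \<Longrightarrow> \<exists>l\<in>\<Lambda>. \<pi> l x \<noteq> \<pi> l x'"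
  shows "conjugate G X \<Phi> (inverse_limit \<Lambda> leq Y induced_bonding) (limit_action \<Lambda> \<Psi>)"
proof -
  let ?L = "inverse_limit \<Lambda> leq Y induced_bonding"
  let ?h = "\<lambda>x. \<lambda>l\<in>\<Lambda>. \<pi> l x"
  note sys = induced_inverse_system
  have cX: "compact_space X" using X by (simp add: dynamical_system_def)
  have \<pi>_in: "\<pi> l x \<in> topspace (Y l)" if "l \<in> \<Lambda>" "x \<in> topspace X" for l x
    using that factor_image[OF that(1)] by auto
  have h_in: "?h x \<in> topspace ?L" if x: "x \<in> topspace X" for x
  proof (rule inverse_limitI[OF sys])
    show "?h x l = induced_bonding m l (?h x m)" if "l \<in> \<Lambda>" "m \<in> \<Lambda>" "leq l m" for l m
      using induced_bonding_eq[OF that x] that by simp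
  qed (use \<pi>_in x in simp_all)
  have "continuous_map X ?L ?h"
    unfolding inverse_limit_def
  proof (rule continuous_map_into_subtopology)
    show "continuous_map X (product_topology Y \<Lambda>) ?h"
      using factor unfolding factor_map_def by (simp add: continuous_map_componentwise image_subset_iff)
    show "?h \<in> topspace X \<rightarrow> {x. \<forall>l\<in>\<Lambda>. \<forall>m\<in>\<Lambda>. leq l m \<longrightarrow> x l = induced_bonding m l (x m)}"
      using h_in unfolding inverse_limit_def by (intro Pi_I) (simp only: topspace_subtopology Int_iff)
  qed
  moreover have "Hausdorff_space ?L"
    unfolding inverse_limit_def
    using Hausdorff by (intro Hausdorff_space_subtopology) (simp add: Hausdorff_space_product_topology)
  moreover have "?h ` topspace X = topspace ?L"
  proof
    show "?h ` topspace X \<subseteq> topspace ?L" using h_in by (intro image_subsetI)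
    show "topspace ?L \<subseteq> ?h ` topspace X"
    proof
      fix y assume y: "y \<in> topspace ?L"
      note yD = inverse_limitD[OF sys y]
      \<comment> \<open>The fibres over the coordinates of the thread \<open>y\<close>.
        Compatibility of \<open>y\<close> makes them shrink along the order, so they have a common
        point.\<close>
      let ?D = "\<lambda>l. {x \<in> topspace X. \<pi> l x \<in> {y l}}"
      have "(\<Inter>l\<in>\<Lambda>. ?D l) \<noteq> {}"
      proof (rule compact_space_directed_Inter[OF cX directed_setD(1)[OF directed]])
        fix l assume l: "l \<in> \<Lambda>"
        have "continuous_map X (Y l) (\<pi> l)" using factor[OF l] unfolding factor_map_def by simp
        then show "closedin X (?D l)"
          by (rule closedin_continuous_map_preimage)
            (rule closedin_Hausdorff_singleton[OF Hausdorff[OF l] yD(1)[OF l]])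
        obtain x where "x \<in> topspace X" "y l = \<pi> l x" using factor_space_lift[OF l yD(1)[OF l]] .
        then have "x \<in> ?D l" by simp
        then show "?D l \<noteq> {}" by (rule ex_in_conv[THEN iffD1, OF exI])
      next
        have mono: "?D m \<subseteq> ?D l" if lm: "l \<in> \<Lambda>" "m \<in> \<Lambda>" "leq l m" for l m
        proof
          fix x assume "x \<in> ?D m"
          then have x: "x \<in> topspace X" "\<pi> m x = y m" by simp_all
          have "\<pi> l x = induced_bonding m l (\<pi> m x)" using induced_bonding_eq[OF lm x(1)] ..
          also have "\<dots> = y l" unfolding x(2) by (rule yD(3)[OF lm, symmetric])
          finally show "x \<in> ?D l" using x(1) by simp
        qed
        fix a b assume ab: "a \<in> \<Lambda>" "b \<in> \<Lambda>"
        obtain c where c: "c \<in> \<Lambda>" "leq a c" "leq b c" using directed_setD(4)[OF directed ab] by auto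
        show "\<exists>c\<in>\<Lambda>. ?D c \<subseteq> ?D a \<inter> ?D b"
          using c(1) mono[OF ab(1) c(1,2)] mono[OF ab(2) c(1,3)] by (intro bexI[of _ c] Int_greatest)
      qed
      then obtain x where x: "\<And>l. l \<in> \<Lambda> \<Longrightarrow> x \<in> ?D l" by (auto simp only: ex_in_conv[symmetric])
      obtain l0 where "l0 \<in> \<Lambda>" using directed_setD(1)[OF directed] by auto
      then have "x \<in> topspace X" using x by simp
      moreover have "y = ?h x"
      proof
        show "y l = ?h x l" for l
          using x[of l] yD(2) by (cases "l \<in> \<Lambda>") (simp_all add: extensional_def)
      qed
      ultimately show "y \<in> ?h ` topspace X" by (rule rev_image_eqI)
    qed
  qed
  moreover have "inj_on ?h (topspace X)"
  proof (rule inj_onI, rule ccontr)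
    fix x x' assume x: "x \<in> topspace X" "x' \<in> topspace X" "?h x = ?h x'" "x \<noteq> x'"
    obtain l where l: "l \<in> \<Lambda>" "\<pi> l x \<noteq> \<pi> l x'" using separating[OF x(1,2,4)] by auto
    have "?h x l = ?h x' l" using x(3) by (rule fun_cong)
    with l show False by simp
  qed
  ultimately have "homeomorphic_map X ?L ?h"
    by (intro continuous_imp_homeomorphic_map[OF _ cX])
  moreover have "?h (\<Phi> g x) = limit_action \<Lambda> \<Psi> g (?h x)" if "g \<in> carrier G" "x \<in> topspace X" for g x
    unfolding limit_action_def
    by (rule restrict_ext) (simp add: factor_equivariant[OF _ that])
  ultimately show ?thesis unfolding conjugate_def by (intro exI[of _ ?h] conjI ballI)
qed

end

section \<open>Itineraries with respect to clopen partitions\<close>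

text \<open>Cells are automatically closed, the complement of one being the union of the others. As
  empty cells are excluded, the empty space has just the empty partition.\<close>

definition clopen_partitions :: "'a topology \<Rightarrow> 'a set set set" where
  "clopen_partitions X =
     {p. finite p \<and> (\<forall>U\<in>p. openin X U \<and> U \<noteq> {}) \<and> pairwise disjnt p \<and> \<Union>p = topspace X}"

text \<open>Serves as the order of the index set, finer partitions being the larger indices.\<close>

definition coarser :: "'a set set \<Rightarrow> 'a set set \<Rightarrow> bool" where
  "coarser p q \<longleftrightarrow> (\<forall>V\<in>q. \<exists>U\<in>p. V \<subseteq> U)"

definition cell :: "'a set set \<Rightarrow> 'a \<Rightarrow> 'a set" where
  "cell p x = (THE U. U \<in> p \<and> x \<in> U)"

lemma cell_eq:
  assumes p: "p \<in> clopen_partitions X" and U: "U \<in> p" "x \<in> U"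
  shows "cell p x = U"
  unfolding cell_def
proof (rule the_equality)
  fix V assume V: "V \<in> p \<and> x \<in> V"
  have "pairwise disjnt p" using p by (simp add: clopen_partitions_def)
  then show "V = U" using U V unfolding pairwise_def disjnt_def by auto
qed (use U in simp)

lemma cell:
  assumes p: "p \<in> clopen_partitions X" and x: "x \<in> topspace X"
  shows "cell p x \<in> p" and "x \<in> cell p x"
proof -
  have "x \<in> \<Union>p" using p x by (simp add: clopen_partitions_def)
  then obtain U where "U \<in> p" "x \<in> U" by auto
  then show "cell p x \<in> p" "x \<in> cell p x" using cell_eq[OF p] by simp_all
qed

lemma coarser_cell:
  assumes pq: "p \<in> clopen_partitions X" "q \<in> clopen_partitions X" "coarser p q"
    and x: "x \<in> topspace X" "x' \<in> topspace X" "cell q x = cell q x'"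
  shows "cell p x = cell p x'"
proof -
  obtain U where U: "U \<in> p" "cell q x \<subseteq> U"
    using pq(3) cell(1)[OF pq(2) x(1)] unfolding coarser_def by auto
  have "x \<in> U" "x' \<in> U" using U(2) cell(2)[OF pq(2)] x by auto
  then show ?thesis using cell_eq[OF pq(1) U(1)] by simp
qed

lemma directed_clopen_partitions: "directed_set (clopen_partitions X) coarser"
  unfolding directed_set_def
proof (intro conjI ballI impI)
  \<comment> \<open>The one-cell partition, with its cell removed when \<open>X\<close> is
    empty.\<close>
  have "{topspace X} - {{}} \<in> clopen_partitions X"
    by (auto simp: clopen_partitions_def pairwise_def)
  then show "clopen_partitions X \<noteq> {}" by auto
next
  fix p assume "p \<in> clopen_partitions X"
  show "coarser p p" by (auto simp: coarser_def)
next
  fix p q r assume "coarser p q \<and> coarser q r"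
  then show "coarser p r" unfolding coarser_def by (meson order_trans)
next
  fix p q assume p: "p \<in> clopen_partitions X" and q: "q \<in> clopen_partitions X"
  \<comment> \<open>The common refinement; empty intersections are discarded because cells must be
    nonempty.\<close>
  let ?r = "(\<lambda>(U, V). U \<inter> V) ` (p \<times> q) - {{}}"
  have "?r \<in> clopen_partitions X"
    unfolding clopen_partitions_def
  proof (intro CollectI conjI ballI)
    show "finite ?r" using p q by (simp add: clopen_partitions_def)
    show "openin X W" "W \<noteq> {}" if "W \<in> ?r" for W
      using that p q by (auto simp: clopen_partitions_def)
    show "pairwise disjnt ?r"
    proof (rule pairwiseI)
      fix W W' assume W: "W \<in> ?r" "W' \<in> ?r" "W \<noteq> W'"
      obtain U V where UV: "U \<in> p" "V \<in> q" "W = U \<inter> V" using W(1) by auto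
      obtain U' V' where UV': "U' \<in> p" "V' \<in> q" "W' = U' \<inter> V'" using W(2) by auto
      have "W = W'" if "x \<in> W" "x \<in> W'" for x
        using that UV UV' cell_eq[OF p UV(1), of x] cell_eq[OF p UV'(1), of x]
          cell_eq[OF q UV(2), of x] cell_eq[OF q UV'(2), of x] by simp
      with W(3) show "disjnt W W'" unfolding disjnt_iff by metis
    qed
    have "\<Union>?r = \<Union>p \<inter> \<Union>q" by auto
    then show "\<Union>?r = topspace X" using p q by (simp add: clopen_partitions_def)
  qed
  moreover have "coarser p ?r" "coarser q ?r" by (auto simp: coarser_def)
  ultimately show "\<exists>r\<in>clopen_partitions X. coarser p r \<and> coarser q r" by (intro bexI conjI)
qed

section \<open>Separating points by clopen partitions\<close>

lemma totally_disconnected_clopen_separation: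
  assumes X: "compact_space X" "Hausdorff_space X" and td: "totally_disconnected_space X"
    and x: "x \<in> topspace X" "y \<in> topspace X" "x \<noteq> y"
  obtains T where "openin X T" "closedin X T" "x \<in> T" "y \<notin> T"
proof -
  have "\<not> quasi_component_of X x y"
  proof
    assume "quasi_component_of X x y"
    then have "connected_component_of X x y"
      using quasi_eq_connected_component_of[of X x] X by simp
    then obtain C where C: "connectedin X C" "x \<in> C" "y \<in> C" unfolding connected_component_of_def by auto
    then obtain a where "C \<subseteq> {a}" using td unfolding totally_disconnected_space_def by auto
    with C x(3) show False by auto
  qed
  then obtain T where T: "closedin X T" "openin X T" "(x \<in> T) \<noteq> (y \<in> T)"
    using x unfolding quasi_component_of_def by auto
  show thesis
  proof (cases "x \<in> T")
    case True
    then show thesis using that[of T] T by simp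
  next
    case False
    then show thesis using that[of "topspace X - T"] T x by auto
  qed
qed

lemma clopen_partitions_separate:
  assumes "compact_space X" "Hausdorff_space X" "totally_disconnected_space X"
    and x: "x \<in> topspace X" "y \<in> topspace X" "x \<noteq> y"
  obtains p where "p \<in> clopen_partitions X" "cell p x \<noteq> cell p y"
proof -
  obtain T where T: "openin X T" "closedin X T" "x \<in> T" "y \<notin> T"
    using totally_disconnected_clopen_separation[OF assms] .
  \<comment> \<open>Two cells suffice; both are nonempty, since one contains \<open>x\<close> and
    the other \<open>y\<close>.\<close>
  let ?p = "{T, topspace X - T}"
  have p: "?p \<in> clopen_partitions X"
    using T x openin_subset[OF T(1)] openin_diff[OF openin_topspace T(2)]
    by (auto simp: clopen_partitions_def pairwise_def disjnt_def)
  have "cell ?p x = T" "cell ?p y = topspace X - T"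
    using cell_eq[OF p, of T x] cell_eq[OF p, of "topspace X - T" y] T x by auto
  then have "cell ?p x \<noteq> cell ?p y" using T by auto
  with p show thesis by (rule that)
qed

text \<open>Numbering the cells gives all partitions alphabets in the one type \<open>nat\<close>.
  Any numbering that is injective on \<open>p\<close> will do.\<close>

definition label :: "'a set set \<Rightarrow> 'a set \<Rightarrow> nat" where
  "label p = (SOME f. inj_on f p)"

lemma inj_on_label: "finite p \<Longrightarrow> inj_on (label p) p"
  unfolding label_def using finite_imp_inj_to_nat_seg by (metis someI_ex)

definition itinerary ::
    "('g, 'm) monoid_scheme \<Rightarrow> ('g \<Rightarrow> 'a \<Rightarrow> 'a) \<Rightarrow> 'a set set \<Rightarrow> 'a \<Rightarrow> 'g \<Rightarrow> nat" where
  "itinerary G \<Phi> p x = (\<lambda>g\<in>carrier G. label p (cell p (\<Phi> g x)))"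

text \<open>The map is constant on cells, and cells are open.\<close>

lemma continuous_map_cell_label:
  assumes p: "p \<in> clopen_partitions X"
  shows "continuous_map X (discrete_topology (label p ` p)) (\<lambda>x. label p (cell p x))"
  unfolding continuous_map_def
proof (intro conjI allI impI)
  show "(\<lambda>x. label p (cell p x)) \<in> topspace X \<rightarrow> topspace (discrete_topology (label p ` p))"
    using cell(1)[OF p] by auto
  fix U
  show "openin X {x \<in> topspace X. label p (cell p x) \<in> U}"
  proof (subst openin_subopen, intro ballI)
    fix x assume x: "x \<in> {x \<in> topspace X. label p (cell p x) \<in> U}"
    then have c: "cell p x \<in> p" "x \<in> cell p x" using cell[OF p] by auto
    have "openin X (cell p x)" using p c(1) by (simp add: clopen_partitions_def)
    moreover have "cell p x \<subseteq> {x \<in> topspace X. label p (cell p x) \<in> U}"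
      using x cell_eq[OF p c(1)] openin_subset[OF calculation] by auto
    ultimately show "\<exists>T. openin X T \<and> x \<in> T \<and> T \<subseteq> {x \<in> topspace X. label p (cell p x) \<in> U}"
      using c(2) by (intro exI[of _ "cell p x"] conjI)
  qed
qed

section \<open>The itinerary map as a factor map onto a subshift\<close>

lemma Hausdorff_full_shift: "Hausdorff_space (full_shift G A)"
  unfolding full_shift_def by (simp add: Hausdorff_space_product_topology)

context
  fixes G :: "('g, 'm) monoid_scheme" and X :: "'a topology" and \<Phi> :: "'g \<Rightarrow> 'a \<Rightarrow> 'a"
  assumes G: "group G" and X: "dynamical_system G X \<Phi>"
begin

text \<open>Since \<open>\<Phi> h\<close> after \<open>\<Phi> g\<close> is the action of the product
  of \<open>h\<close> and \<open>g\<close>, the new entry at \<open>h\<close> is the old entry at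
  that product, which is exactly the right multiplication in \<open>shift_action\<close>.\<close>

lemma itinerary_equivariant:
  assumes "g \<in> carrier G" "x \<in> topspace X"
  shows "itinerary G \<Phi> p (\<Phi> g x) = shift_action G g (itinerary G \<Phi> p x)"
proof -
  have "\<Phi> (h \<otimes>\<^bsub>G\<^esub> g) x = \<Phi> h (\<Phi> g x)" "h \<otimes>\<^bsub>G\<^esub> g \<in> carrier G" if "h \<in> carrier G" for h
    using X assms that G by (simp_all add: dynamical_system_def monoid.m_closed group.is_monoid)
  then show ?thesis
    unfolding itinerary_def shift_action_def by (intro restrict_ext) simp
qed

lemma continuous_itinerary:
  assumes p: "p \<in> clopen_partitions X"
  shows "continuous_map X (full_shift G (label p ` p)) (itinerary G \<Phi> p)"
  unfolding full_shift_def continuous_map_componentwise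
proof (intro conjI ballI)
  show "itinerary G \<Phi> p ` topspace X \<subseteq> extensional (carrier G)"
    by (auto simp: itinerary_def)
  fix g assume g: "g \<in> carrier G"
  have "continuous_map X X (\<Phi> g)"
    using X g by (simp add: dynamical_system_def homeomorphic_imp_continuous_map)
  from continuous_map_compose[OF this continuous_map_cell_label[OF p]]
  show "continuous_map X (discrete_topology (label p ` p)) (\<lambda>x. itinerary G \<Phi> p x g)"
    using g by (simp add: itinerary_def o_def)
qed

text \<open>Closed because it is a compact subset of the Hausdorff full shift; invariant because a
  shifted itinerary is the itinerary of the translated point.\<close>

lemma subshift_itineraries:
  assumes p: "p \<in> clopen_partitions X"
  shows "subshift G (label p ` p) (itinerary G \<Phi> p ` topspace X)"
  unfolding subshift_def
proof (intro conjI ballI)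
  show "finite (label p ` p)" using p by (simp add: clopen_partitions_def)
  have "compactin (full_shift G (label p ` p)) (itinerary G \<Phi> p ` topspace X)"
    using X by (intro image_compactin[OF _ continuous_itinerary[OF p]])
      (simp add: dynamical_system_def compact_space_def)
  then show "closedin (full_shift G (label p ` p)) (itinerary G \<Phi> p ` topspace X)"
    by (rule compactin_imp_closedin[OF Hausdorff_full_shift])
  fix g assume g: "g \<in> carrier G"
  show "shift_action G g ` itinerary G \<Phi> p ` topspace X \<subseteq> itinerary G \<Phi> p ` topspace X"
    unfolding image_image
  proof (rule image_subsetI)
    fix x assume x: "x \<in> topspace X"
    show "shift_action G g (itinerary G \<Phi> p x) \<in> itinerary G \<Phi> p ` topspace X"
      unfolding itinerary_equivariant[OF g x, symmetric]
      by (rule imageI[OF dynamical_system_action_in[OF X g x]])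
  qed
qed

lemma factor_map_itinerary:
  assumes p: "p \<in> clopen_partitions X"
  shows "factor_map G X \<Phi> (subshift_space G (label p ` p) (itinerary G \<Phi> p ` topspace X))
           (shift_action G) (itinerary G \<Phi> p)"
  unfolding factor_map_def
proof (intro conjI ballI)
  let ?I = "itinerary G \<Phi> p ` topspace X"
  show "continuous_map X (subshift_space G (label p ` p) ?I) (itinerary G \<Phi> p)"
    unfolding subshift_space_def
    by (rule continuous_map_into_subtopology[OF continuous_itinerary[OF p]]) simp
  have "?I \<subseteq> topspace (full_shift G (label p ` p))"
    using subshift_itineraries[OF p] unfolding subshift_def by (intro closedin_subset) simp
  then show "?I = topspace (subshift_space G (label p ` p) ?I)"
    unfolding subshift_space_def by (simp only: topspace_subtopology Int_absorb1)
qed (simp_all add: dynamical_system_action_in[OF X] itinerary_equivariant)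

text \<open>Injective labels recover the cell in \<open>q\<close> of each translate, and that
  determines its cell in \<open>p\<close>. This supplies the assumption \<open>refines\<close> for
  the family of itinerary maps.\<close>

lemma coarser_itinerary:
  assumes pq: "p \<in> clopen_partitions X" "q \<in> clopen_partitions X" "coarser p q"
    and x: "x \<in> topspace X" "x' \<in> topspace X" "itinerary G \<Phi> q x = itinerary G \<Phi> q x'"
  shows "itinerary G \<Phi> p x = itinerary G \<Phi> p x'"
  unfolding itinerary_def
proof (rule restrict_ext)
  fix g assume g: "g \<in> carrier G"
  note \<Phi> = dynamical_system_action_in[OF X g x(1)] dynamical_system_action_in[OF X g x(2)]
  have "label q (cell q (\<Phi> g x)) = label q (cell q (\<Phi> g x'))"
    using fun_cong[OF x(3), of g] g by (simp add: itinerary_def)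
  moreover have "finite q" using pq(2) by (simp add: clopen_partitions_def)
  ultimately have "cell q (\<Phi> g x) = cell q (\<Phi> g x')"
    using inj_onD[OF inj_on_label] cell(1)[OF pq(2)] \<Phi> by auto
  then show "label p (cell p (\<Phi> g x)) = label p (cell p (\<Phi> g x'))"
    using coarser_cell[OF pq \<Phi>] by simp
qed

lemma itinerary_separates:
  assumes "totally_disconnected_space X" and x: "x \<in> topspace X" "y \<in> topspace X" "x \<noteq> y"
  shows "\<exists>p\<in>clopen_partitions X. itinerary G \<Phi> p x \<noteq> itinerary G \<Phi> p y"
proof -
  have "compact_space X" "Hausdorff_space X" using X by (simp_all add: dynamical_system_def)
  then obtain p where p: "p \<in> clopen_partitions X" "cell p x \<noteq> cell p y"
    using clopen_partitions_separate[OF _ _ assms] by auto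
  have "label p (cell p x) \<noteq> label p (cell p y)"
  proof
    assume "label p (cell p x) = label p (cell p y)"
    moreover have "finite p" using p(1) by (simp add: clopen_partitions_def)
    ultimately show False
      using inj_onD[OF inj_on_label] cell(1)[OF p(1)] x p(2) by auto
  qed
  \<comment> \<open>The entry at the identity records the cell of the point itself.\<close>
  then have "itinerary G \<Phi> p x \<one>\<^bsub>G\<^esub> \<noteq> itinerary G \<Phi> p y \<one>\<^bsub>G\<^esub>"
    using X x G by (simp add: itinerary_def dynamical_system_def monoid.one_closed group.is_monoid)
  then have "itinerary G \<Phi> p x \<noteq> itinerary G \<Phi> p y" by auto
  with p(1) show ?thesis by (rule bexI[rotated])
qed

text \<open>All clopen partitions serve as indices, so the system is the same for every property;
  \<open>P\<close> enters only because the subshifts of itineraries are factors of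
  \<open>X\<close>.\<close>

lemma conjugate_limit_if_has_property:
  assumes td: "totally_disconnected_space X" and P: "has_property P G X \<Phi>"
  shows "\<exists>(\<Lambda> :: 'a set set set) leq (A :: 'a set set \<Rightarrow> nat set) S \<phi>.
           mittag_leffler_system_of_subshifts P G \<Lambda> leq A S \<phi> \<and>
           conjugate_to_limit_of_subshifts G X \<Phi> \<Lambda> leq A S \<phi>"
proof -
  let ?\<Lambda> = "clopen_partitions X"
  let ?A = "\<lambda>p :: 'a set set. label p ` p"
  let ?S = "\<lambda>p. itinerary G \<Phi> p ` topspace X"
  let ?Y = "\<lambda>p. subshift_space G (?A p) (?S p)"
  let ?\<phi> = "induced_bonding X (itinerary G \<Phi>)"
  have H: "Hausdorff_space (?Y p)" for p
    unfolding subshift_space_def by (intro Hausdorff_space_subtopology Hausdorff_full_shift)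
  \<comment> \<open>These discharge, in order, the assumptions under which the induced inverse
    system was built.\<close>
  note hyps = G X directed_clopen_partitions[of X] factor_map_itinerary H coarser_itinerary
  have "mittag_leffler_system_of_subshifts P G ?\<Lambda> coarser ?A ?S ?\<phi>"
    unfolding mittag_leffler_system_of_subshifts_def
  proof (intro conjI ballI)
    fix p assume p: "p \<in> ?\<Lambda>"
    show "subshift G (?A p) (?S p)" by (rule subshift_itineraries[OF p])
    show "has_property P G (?Y p) (shift_action G)"
      by (rule has_property_factor[OF G factor_map_itinerary[OF p] P])
  next
    show "inverse_system G ?\<Lambda> coarser ?Y (\<lambda>_. shift_action G) ?\<phi>"
      by (rule induced_inverse_system[OF hyps])
    show "mittag_leffler ?\<Lambda> coarser ?Y ?\<phi>"
      by (rule induced_mittag_leffler[OF hyps])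
  qed
  moreover have "conjugate_to_limit_of_subshifts G X \<Phi> ?\<Lambda> coarser ?A ?S ?\<phi>"
    unfolding conjugate_to_limit_of_subshifts_def
    by (rule conjugate_induced_inverse_limit[OF hyps itinerary_separates[OF td]])
  ultimately show ?thesis by (intro exI conjI)
qed

end

text \<open>Types cannot be quantified inside the formula. So existence is asserted with indices in
  \<open>'a set set\<close> and alphabets in \<open>nat\<close>, where clopen partitions and their
  labels live, and the converse is recorded once more for arbitrary types \<open>'i\<close> and
  \<open>'s\<close>.\<close>

theorem theorem1p4:
  fixes G :: "('g, 'm) monoid_scheme"
    and X :: "'a topology"
    and \<Phi> :: "'g \<Rightarrow> 'a \<Rightarrow> 'a"
    and P :: dyn_property
  assumes "group G"
    and "countable (carrier G)"
    and "dynamical_system G X \<Phi>"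
    and "totally_disconnected_space X"
  shows "(has_property P G X \<Phi> \<longleftrightarrow>
           (\<exists>(\<Lambda> :: 'a set set set) leq (A :: 'a set set \<Rightarrow> nat set) S \<phi>.
              mittag_leffler_system_of_subshifts P G \<Lambda> leq A S \<phi> \<and>
              conjugate_to_limit_of_subshifts G X \<Phi> \<Lambda> leq A S \<phi>)) \<and>
         ((\<exists>(\<Lambda> :: 'i set) leq (A :: 'i \<Rightarrow> 's set) S \<phi>.
              mittag_leffler_system_of_subshifts P G \<Lambda> leq A S \<phi> \<and>
              conjugate_to_limit_of_subshifts G X \<Phi> \<Lambda> leq A S \<phi>) \<longrightarrow>
          has_property P G X \<Phi>)"
proof (intro conjI iffI impI; (elim exE conjE)?)
  assume "has_property P G X \<Phi>"
  then show "\<exists>(\<Lambda> :: 'a set set set) leq (A :: 'a set set \<Rightarrow> nat set) S \<phi>.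
              mittag_leffler_system_of_subshifts P G \<Lambda> leq A S \<phi> \<and>
              conjugate_to_limit_of_subshifts G X \<Phi> \<Lambda> leq A S \<phi>"
    by (rule conjugate_limit_if_has_property[OF assms(1,3,4)])
qed (rule has_property_if_conjugate_limit[OF assms(1,3)]; assumption)+

end
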